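(* Let $p$ be a prime and let $S$ be the set of all formal power series of the form $$t+\sum_{k\ge 1}\left(a_{pk}t^{pk}+a_{pk+1}t^{pk+1}\right),\qquad a_{pk},a_{pk+1}\in\mathbb F_p,$$ that is, $S=\{t+\sum_{\lambda\in B}a_\lambda t^{\lambda+1}: a_\lambda\in\mathbb F_p\}$ with $B=p\mathbb N\cup(p\mathbb N-1)$, a closed subgroup of the Nottingham group $\mathcal J$ over $\mathbb F_p$. Then $S$ is a hereditarily just infinite pro-$p$ group, and $S$ contains non-trivial elements of finite order.
   Context: The Nottingham group $\mathcal J$ over $\mathbb F_p$ is the group $\{t+\sum_{k\ge1}a_kt^{k+1}: a_k\in\mathbb F_p\}$ of formal power series under substitution (composition), $(f\circ g)(t)=f(g(t))$; it is a pro-$p$ group with the topology in which the subgroups $\{f: f\equiv t \bmod t^{n}\}$ form a base of open neighbourhoods of the identity $t$. A pro-$p$ group $G$ is hereditarily just infinite if it is infinite and every non-trivial closed normal subgroup of every open subgroup of $G$ is open. *)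

theory Defs
  imports "HOL-Computational_Algebra.Formal_Power_Series" "HOL-Algebra.Algebra"
begin

definition Nott :: "('a::field) fps monoid" where
  "Nott = \<lparr>carrier = {f. fps_nth f 0 = 0 \<and> fps_nth f 1 = 1}, mult = (\<lambda>f g. f oo g), one = fps_X\<rparr>"

definition agree_mod :: "nat \<Rightarrow> ('a::field) fps \<Rightarrow> 'a fps \<Rightarrow> bool" where
  "agree_mod n f g \<longleftrightarrow> (\<forall>k<n. fps_nth f k = fps_nth g k)"

text \<open>Openness of U relative to the subspace G of the Nottingham group, for the
  topology with basic open sets the cosets f N_n = {g. g = f mod t^n}.\<close>
definition nott_open :: "('a::field) fps set \<Rightarrow> 'a fps set \<Rightarrow> bool" where
  "nott_open G U \<longleftrightarrow> U \<subseteq> G \<and> (\<forall>f\<in>U. \<exists>n. \<forall>g\<in>G. agree_mod n g f \<longrightarrow> g \<in> U)"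

definition nott_closed :: "('a::field) fps set \<Rightarrow> 'a fps set \<Rightarrow> bool" where
  "nott_closed G H \<longleftrightarrow> H \<subseteq> G \<and> nott_open G (G - H)"

definition S_set :: "nat \<Rightarrow> ('a::field) fps set" where
  "S_set p = {f \<in> carrier Nott. \<forall>n\<ge>2. fps_nth f n \<noteq> 0 \<longrightarrow> (p dvd n \<or> p dvd (n - 1))}"

text \<open>Pro-p (for a closed subgroup G of the Nottingham group, which is compact):
  every open normal subgroup has finite index a power of p.\<close>
definition nott_pro_p :: "nat \<Rightarrow> ('a::field) fps set \<Rightarrow> bool" where
  "nott_pro_p p G \<longleftrightarrow> subgroup G Nott \<and> nott_closed (carrier Nott) G \<and>
     (\<forall>U. U \<lhd> (Nott\<lparr>carrier := G\<rparr>) \<and> nott_open G U \<longrightarrow>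
        (\<exists>e. card (rcosets\<^bsub>Nott\<lparr>carrier := G\<rparr>\<^esub> U) = p ^ e))"

definition nott_hji :: "('a::field) fps set \<Rightarrow> bool" where
  "nott_hji G \<longleftrightarrow> infinite G \<and>
     (\<forall>U N. subgroup U (Nott\<lparr>carrier := G\<rparr>) \<and> nott_open G U \<and>
        N \<lhd> (Nott\<lparr>carrier := U\<rparr>) \<and> nott_closed U N \<and> N \<noteq> {fps_X}
        \<longrightarrow> nott_open U N)"

end

theory Submission
  imports Defs "HOL-Number_Theory.Residues" "HOL-Computational_Algebra.Formal_Laurent_Series"
begin

text \<open>Since \<open>g(t)\<^sup>p = g(t\<^sup>p)\<close> over the prime field, the elements of \<open>S\<close> are the affine maps
  \<open>A(t\<^sup>p) t + B(t\<^sup>p)\<close>, and in the coordinates \<open>(A, B)\<close> composition reads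
  \<open>(C, D) (A, B) = (C(g) A, C(g) B + D(g))\<close> with \<open>g = A(t\<^sup>p) t + B(t\<^sup>p)\<close>.

  Let \<open>N\<close> be closed, non-trivial and normal in an open subgroup. The commutator of an element of
  \<open>N\<close> with \<open>(1 + a x\<^sup>j, 0)\<close>, \<open>p\<close> not dividing \<open>j\<close>, has non-trivial linear part, and the commutators
  of the latter with translations \<open>(1, b x\<^sup>k)\<close> give elements of \<open>N\<close> that are translations to very
  high order, with arbitrary leading term \<open>b x\<^sup>l\<close> for all large \<open>l\<close>. Multiplying by them
  clears the translation part of any further commutator without disturbing the leading term of its
  linear part. If \<open>h \<in> N\<close> has depth \<open>m\<close>, that is, \<open>h - t\<close> has order \<open>m + 1\<close>, this gives elements
  of \<open>N\<close> with leading term \<open>a x\<^sup>M\<close> in the linear part for all large \<open>M\<close> not congruent to \<open>m\<close>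
  modulo \<open>p\<close>; depths \<open>m\<close> congruent to \<open>-1\<close> and to \<open>0\<close> both occur, so all large \<open>M\<close> are reached.
  Hence \<open>N\<close> contains elements with every admissible leading term of large order, and by
  closedness a whole congruence subgroup.\<close>

section \<open>Congruences of power series modulo powers of the variable\<close>

lemma fps_X_power_dvd_iff:
  fixes u :: "'a::field fps"
  shows "fps_X ^ n dvd u \<longleftrightarrow> (\<forall>k<n. fps_nth u k = 0)"
proof
  assume "fps_X ^ n dvd u"
  then obtain v where "u = fps_X ^ n * v" by (rule dvdE)
  then show "\<forall>k<n. fps_nth u k = 0" by (simp add: fps_X_power_mult_nth)
next
  assume "\<forall>k<n. fps_nth u k = 0"
  then have "fps_cutoff n u = 0" by (intro fps_ext) simp
  then show "fps_X ^ n dvd u"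
    using fps_shift_cutoff'[of n u] by (metis add.right_neutral dvd_triv_left)
qed

lemma fps_X_dvd_iff: "fps_X dvd (u :: 'a::field fps) \<longleftrightarrow> fps_nth u 0 = 0"
  using fps_X_power_dvd_iff[of 1 u] by simp

lemma fps_X_power_dvd_weaken:
  fixes u :: "'a::field fps"
  shows "fps_X ^ n dvd u \<Longrightarrow> m \<le> n \<Longrightarrow> fps_X ^ m dvd u"
  using le_imp_power_dvd dvd_trans by blast

lemma dvd_diff_trans:
  fixes a b c d :: "'a::comm_ring_1"
  assumes "d dvd a - b" "d dvd b - c"
  shows "d dvd a - c"
  using dvd_add[OF assms] by (simp only: diff_add_cancel add_diff_eq)

lemma fps_X_power_dvd_of_dvd_diff:
  fixes u v :: "'a::field fps"
  shows "fps_X ^ Suc n dvd u - v \<Longrightarrow> fps_X ^ n dvd v \<Longrightarrow> fps_X ^ n dvd u"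
  using fps_X_power_dvd_weaken[of "Suc n" "u - v" n] dvd_add[of "fps_X ^ n" "u - v" v] by simp

lemma fps_X_power_dvd_mult:
  fixes u v :: "'a::field fps"
  assumes "fps_X ^ m dvd u" "fps_X ^ n dvd v" "k \<le> m + n"
  shows "fps_X ^ k dvd u * v"
  using fps_X_power_dvd_weaken[OF _ assms(3)] mult_dvd_mono[OF assms(1,2)]
  by (simp add: power_add)

lemma fps_X_power_dvd_unit_cancel:
  fixes u v :: "'a::field fps"
  assumes "fps_X ^ n dvd u * v" "fps_nth v 0 \<noteq> 0"
  shows "fps_X ^ n dvd u"
proof -
  have "u = (u * v) * inverse v"
    using assms(2) by (simp add: mult.assoc inverse_mult_eq_1')
  then show ?thesis using assms(1) by (metis dvd_mult2)
qed

lemma fps_X_power_dvd_compose: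
  fixes u g :: "'a::field fps"
  assumes "fps_X ^ n dvd u" "fps_nth g 0 = 0"
  shows "fps_X ^ n dvd u oo g"
proof -
  obtain v where "u = fps_X ^ n * v" using assms(1) by (rule dvdE)
  then have "u oo g = g ^ n * (v oo g)"
    using assms(2) by (simp add: fps_compose_mult_distrib flip: fps_compose_power)
  moreover have "fps_X ^ n dvd g ^ n"
    using assms(2) by (simp add: dvd_power_same fps_X_dvd_iff)
  ultimately show ?thesis by simp
qed

text \<open>Telescoping splits off one factor at a time, and both resulting pieces gain the depth
  \<open>m\<close>.\<close>

lemma fps_X_power_dvd_power_diff:
  fixes g :: "'a::field fps"
  assumes "fps_X ^ Suc m dvd g - fps_X"
  shows "fps_X ^ (m + i) dvd g ^ i - fps_X ^ i"
proof (induction i)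
  case (Suc i)
  have "fps_nth g 0 = 0"
    using assms unfolding fps_X_power_dvd_iff by (metis fps_X_nth fps_sub_nth right_minus_eq zero_less_Suc zero_neq_one)
  then have "fps_X dvd g" by (simp add: fps_X_dvd_iff)
  then have "fps_X ^ (m + Suc i) dvd g * (g ^ i - fps_X ^ i)"
    by (intro fps_X_power_dvd_mult[of 1 g "m + i" "g ^ i - fps_X ^ i"]) (use Suc in simp_all)
  moreover have "fps_X ^ (m + Suc i) dvd (g - fps_X) * fps_X ^ i"
    by (rule fps_X_power_dvd_mult[OF assms, of i "fps_X ^ i"]) simp_all
  moreover have "g ^ Suc i - fps_X ^ Suc i = g * (g ^ i - fps_X ^ i) + (g - fps_X) * fps_X ^ i"
    by (simp add: algebra_simps)
  ultimately show ?case by (metis dvd_add)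
qed simp

text \<open>First-order expansion of a power: the cross term
  \<open>(g - fps_X) * (g ^ i - fps_X ^ i)\<close> gains an extra order because
  \<open>m \<ge> 1\<close>. The factor \<open>of_nat i\<close> is what later calls for exponents
  prime to \<open>p\<close>.\<close>

lemma fps_power_diff_leading:
  fixes g :: "'a::field fps"
  assumes "fps_X ^ (m + 2) dvd g - fps_X - fps_const b * fps_X ^ Suc m" "m \<ge> 1"
  shows "fps_X ^ Suc (m + i) dvd g ^ i - fps_X ^ i - fps_const (of_nat i * b) * fps_X ^ (m + i)"
proof (induction i)
  case (Suc i)
  have 1: "fps_X ^ Suc m dvd g - fps_X"
    using dvd_add[OF fps_X_power_dvd_weaken[OF assms(1), of "Suc m"], of "fps_const b * fps_X ^ Suc m"]
    by simp
  then have 2: "fps_X ^ 2 dvd g - fps_X"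
    by (rule fps_X_power_dvd_weaken) (use assms(2) in simp)
  have "fps_X ^ Suc (m + Suc i) dvd (g - fps_X) * (g ^ i - fps_X ^ i)"
    by (rule fps_X_power_dvd_mult[OF 2 fps_X_power_dvd_power_diff[OF 1, of i]]) simp
  moreover have "fps_X ^ Suc (m + Suc i) dvd
      fps_X * (g ^ i - fps_X ^ i - fps_const (of_nat i * b) * fps_X ^ (m + i))"
    using Suc by (simp add: mult_dvd_mono)
  moreover have "fps_X ^ Suc (m + Suc i) dvd (g - fps_X - fps_const b * fps_X ^ Suc m) * fps_X ^ i"
    by (rule fps_X_power_dvd_mult[OF assms(1), of i "fps_X ^ i"]) simp_all
  moreover have "g ^ Suc i - fps_X ^ Suc i - fps_const (of_nat (Suc i) * b) * fps_X ^ (m + Suc i) =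
      (g - fps_X) * (g ^ i - fps_X ^ i)
      + fps_X * (g ^ i - fps_X ^ i - fps_const (of_nat i * b) * fps_X ^ (m + i))
      + (g - fps_X - fps_const b * fps_X ^ Suc m) * fps_X ^ i"
    by (simp add: algebra_simps power_add flip: fps_const_add fps_const_mult)
  ultimately show ?case by (metis dvd_add)
qed simp

text \<open>Coefficients of \<open>u\<close> below \<open>n\<close> vanish, and each later power
  \<open>g ^ i\<close> differs from \<open>fps_X ^ i\<close> only from order \<open>m + i\<close>
  on.\<close>

lemma fps_X_power_dvd_compose_diff:
  fixes u g :: "'a::field fps"
  assumes "fps_X ^ n dvd u" "fps_X ^ Suc m dvd g - fps_X" "k \<le> n + m"
  shows "fps_X ^ k dvd (u oo g) - u"
  unfolding fps_X_power_dvd_iff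
proof (intro allI impI)
  fix l assume "l < k"
  have "fps_nth (u oo g) l - fps_nth (u oo fps_X) l
      = (\<Sum>i=0..l. fps_nth u i * fps_nth (g ^ i - fps_X ^ i) l)"
    unfolding fps_compose_nth by (simp only: fps_sub_nth right_diff_distrib sum_subtractf)
  also have "\<dots> = 0"
  proof (rule sum.neutral, rule ballI)
    fix i
    show "fps_nth u i * fps_nth (g ^ i - fps_X ^ i) l = 0"
    proof (cases "i < n")
      case True
      then show ?thesis using assms(1) by (simp add: fps_X_power_dvd_iff)
    next
      case False
      then have "l < m + i" using \<open>l < k\<close> assms(3) by simp
      then have "fps_nth (g ^ i - fps_X ^ i) l = 0"
        using fps_X_power_dvd_power_diff[OF assms(2), of i] unfolding fps_X_power_dvd_iff by blast
      then show ?thesis by simp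
    qed
  qed
  finally show "fps_nth ((u oo g) - u) l = 0" by simp
qed

section \<open>The Nottingham group\<close>

lemma Nott_carrier_iff: "f \<in> carrier Nott \<longleftrightarrow> fps_nth f 0 = 0 \<and> fps_nth f 1 = 1"
  by (simp add: Nott_def)

lemma Nott_mult: "f \<otimes>\<^bsub>Nott\<^esub> g = f oo g"
  by (simp add: Nott_def)

lemma Nott_one: "\<one>\<^bsub>Nott\<^esub> = fps_X"
  by (simp add: Nott_def)

lemma Nott_carrier_iff_dvd: "f \<in> carrier Nott \<longleftrightarrow> fps_X ^ 2 dvd f - fps_X"
  unfolding fps_X_power_dvd_iff Nott_carrier_iff by (auto simp: less_2_cases_iff)

lemma Nott_compose_closed: "f \<in> carrier Nott \<Longrightarrow> g \<in> carrier Nott \<Longrightarrow> f oo g \<in> carrier Nott"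
  by (simp add: Nott_carrier_iff fps_compose_nth)

lemma fps_inv_in_Nott:
  assumes "f \<in> carrier Nott"
  shows "fps_inv f \<in> carrier Nott"
  using assms by (simp add: Nott_carrier_iff fps_inv_def)

lemma group_Nott: "group (Nott :: 'a::field fps monoid)"
proof (rule groupI)
  fix f g h :: "'a fps"
  assume "f \<in> carrier Nott" "g \<in> carrier Nott" "h \<in> carrier Nott"
  then show "f \<otimes>\<^bsub>Nott\<^esub> g \<otimes>\<^bsub>Nott\<^esub> h = f \<otimes>\<^bsub>Nott\<^esub> (g \<otimes>\<^bsub>Nott\<^esub> h)"
    by (simp add: Nott_mult Nott_carrier_iff fps_compose_assoc)
next
  fix f :: "'a fps"
  assume f: "f \<in> carrier Nott"
  have "fps_inv f oo f = fps_X"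
    by (rule fps_inv) (use f in \<open>simp_all add: Nott_carrier_iff\<close>)
  then show "\<exists>g\<in>carrier Nott. g \<otimes>\<^bsub>Nott\<^esub> f = \<one>\<^bsub>Nott\<^esub>"
    using fps_inv_in_Nott[OF f] by (auto simp: Nott_mult Nott_one)
qed (simp_all add: Nott_compose_closed Nott_mult Nott_one, simp_all add: Nott_carrier_iff)

lemma Nott_inv:
  assumes "f \<in> carrier Nott"
  shows "inv\<^bsub>Nott\<^esub> f = fps_inv f"
proof (rule group.inv_equality[OF group_Nott])
  show "fps_inv f \<otimes>\<^bsub>Nott\<^esub> f = \<one>\<^bsub>Nott\<^esub>"
    unfolding Nott_mult Nott_one by (rule fps_inv) (use assms in \<open>simp_all add: Nott_carrier_iff\<close>)
qed (use assms fps_inv_in_Nott in auto)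

lemma compose_fps_inv:
  assumes "f \<in> carrier Nott"
  shows "f oo fps_inv f = fps_X" "fps_inv f oo f = fps_X"
  using assms fps_inv_right[of f] fps_inv[of f] by (simp_all add: Nott_carrier_iff)

lemma compose_fps_inv_cancel:
  assumes "f \<in> carrier Nott"
  shows "u oo f oo fps_inv f = u" "u oo fps_inv f oo f = u"
  using assms compose_fps_inv[OF assms] fps_inv_in_Nott[OF assms]
  by (simp_all add: Nott_carrier_iff flip: fps_compose_assoc)

lemma fps_X_power_dvd_compose_iff:
  assumes "g \<in> carrier Nott"
  shows "fps_X ^ n dvd u oo g \<longleftrightarrow> fps_X ^ n dvd u"
proof
  assume "fps_X ^ n dvd u oo g"
  then have "fps_X ^ n dvd u oo g oo fps_inv g"
    by (rule fps_X_power_dvd_compose) (use fps_inv_in_Nott[OF assms] in \<open>simp add: Nott_carrier_iff\<close>)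
  then show "fps_X ^ n dvd u" by (simp add: compose_fps_inv_cancel[OF assms])
qed (use assms in \<open>auto simp: Nott_carrier_iff intro: fps_X_power_dvd_compose\<close>)

lemma fps_X_power_dvd_compose_Nott_diff:
  assumes "g \<in> carrier Nott" "fps_X ^ n dvd u"
  shows "fps_X ^ Suc n dvd (u oo g) - u"
  by (rule fps_X_power_dvd_compose_diff[OF assms(2), of 1])
     (use assms(1) in \<open>simp_all add: Nott_carrier_iff_dvd numeral_2_eq_2\<close>)

lemma leading_term:
  assumes "f \<in> carrier Nott" "f \<noteq> fps_X"
  obtains m b where "fps_X ^ (m + 2) dvd f - fps_X - fps_const b * fps_X ^ Suc m" "b \<noteq> 0" "m \<ge> 1"
proof -
  define n where "n = subdegree (f - fps_X)"
  have nz: "f - fps_X \<noteq> 0" using assms(2) by simp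
  have "n \<ge> 2"
    unfolding n_def using assms(1) nz
    by (intro subdegree_geI) (auto simp: Nott_carrier_iff_dvd fps_X_power_dvd_iff)
  \<comment> \<open>Passage from the order \<open>n\<close> of \<open>f - fps_X\<close> to the depth
    of \<open>f\<close>.\<close>
  define m where "m = n - 1"
  have m: "n = Suc m" "m \<ge> 1" using \<open>n \<ge> 2\<close> by (simp_all add: m_def)
  have "fps_X ^ (m + 2) dvd f - fps_X - fps_const (fps_nth (f - fps_X) n) * fps_X ^ Suc m"
    unfolding fps_X_power_dvd_iff
  proof (intro allI impI)
    fix k assume "k < m + 2"
    then consider "k < n" | "k = n" using m by linarith
    then show "fps_nth (f - fps_X - fps_const (fps_nth (f - fps_X) n) * fps_X ^ Suc m) k = 0"
    proof cases
      case 1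
      then have "fps_nth (f - fps_X) k = 0" unfolding n_def by (rule nth_less_subdegree_zero)
      then show ?thesis using 1 m by (simp del: power_Suc)
    qed (simp add: m del: power_Suc)
  qed
  moreover have "fps_nth (f - fps_X) n \<noteq> 0"
    using nz unfolding n_def by (rule nth_subdegree_nonzero)
  ultimately show thesis using that m(2) by blast
qed

lemma S_set_nth_eq_0:
  assumes "f \<in> S_set p" "n \<ge> 2" "\<not> p dvd n" "\<not> p dvd n - 1"
  shows "fps_nth f n = 0"
  using assms by (auto simp: S_set_def)

lemma agree_mod_iff_dvd: "agree_mod n f g \<longleftrightarrow> fps_X ^ n dvd f - g"
  by (simp add: agree_mod_def fps_X_power_dvd_iff)

section \<open>Affine coordinates\<close>

text \<open>Both images are in bijection with the classes of the common kernel relation. The maps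
  will be truncation and truncation after right composition.\<close>

lemma card_image_cong_kernel:
  assumes "\<And>x y. x \<in> A \<Longrightarrow> y \<in> A \<Longrightarrow> g x = g y \<longleftrightarrow> h x = h y"
  shows "card (g ` A) = card (h ` A)"
proof -
  have "bij_betw (\<lambda>z. h (inv_into A g z)) (g ` A) (h ` A)"
    unfolding bij_betw_def
  proof
    show "inj_on (\<lambda>z. h (inv_into A g z)) (g ` A)"
      by (rule inj_onI) (metis assms f_inv_into_f inv_into_into)
    have "h (inv_into A g (g x)) = h x" if "x \<in> A" for x
      using that assms by (metis f_inv_into_f imageI inv_into_into)
    then show "(\<lambda>z. h (inv_into A g z)) ` g ` A = h ` A" by (auto simp: image_image)
  qed
  then show ?thesis by (rule bij_betw_same_card)
qed

text \<open>The support of the series \<open>W\<close> below; the guard \<open>p < 2\<close> keeps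
  the recursion terminating for arbitrary \<open>p\<close>.\<close>

fun extremal_digits :: "nat \<Rightarrow> nat \<Rightarrow> bool" where
  "extremal_digits p n = (if n = 0 \<or> p < 2 then True
     else if n mod p = 0 \<or> n mod p = p - 1 then extremal_digits p (n div p) else False)"

declare extremal_digits.simps [simp del]

text \<open>The parameter \<open>F\<close> ties the locale to the type \<open>'a\<close>, which
  \<open>p\<close> alone does not mention.\<close>

locale prime_order_field =
  fixes p :: nat and F :: "'a::field itself"
  assumes prime_p: "Factorial_Ring.prime p" and card_field: "card (UNIV :: 'a set) = p"
begin

lemma p_ge_2: "p \<ge> 2"
  using prime_p by (rule prime_ge_2_nat)

lemma double_le: "n + n \<le> p * n"
  using mult_le_mono1[OF p_ge_2, of n] by (simp only: mult_2)

lemma le_p_mult: "n \<le> p * n"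
  using double_le[of n] by linarith

lemma finite_field: "finite (UNIV :: 'a set)"
  using card_field p_ge_2 card.infinite by fastforce

lemma CHAR_eq_p: "CHAR('a) = p"
proof -
  have "CHAR('a) dvd p" using CHAR_dvd_CARD[where 'a = 'a] card_field by simp
  moreover have "CHAR('a) \<noteq> 1" by simp
  ultimately show ?thesis using prime_p by (auto simp: prime_nat_iff)
qed

lemma of_nat_eq_0_iff_p_dvd: "of_nat n = (0 :: 'a) \<longleftrightarrow> p dvd n"
  by (simp add: of_nat_eq_0_iff_char_dvd CHAR_eq_p)

text \<open>A field with \<open>p\<close> elements consists of the residues \<open>of_nat n\<close>,
  \<open>n < p\<close>, which are distinct in characteristic \<open>p\<close>; on these, additivity
  of the \<open>p\<close>-th power gives the claim.\<close>

lemma fermat: "a ^ p = (a :: 'a)"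
proof -
  have "inj_on (of_nat :: nat \<Rightarrow> 'a) {..<p}"
    by (auto intro!: inj_onI simp: of_nat_eq_iff_cong_CHAR CHAR_eq_p cong_def)
  then have "card ((of_nat :: nat \<Rightarrow> 'a) ` {..<p}) = card (UNIV :: 'a set)"
    by (simp add: card_image card_field)
  then have "(of_nat :: nat \<Rightarrow> 'a) ` {..<p} = UNIV"
    using card_subset_eq[OF finite_field] by blast
  then obtain n where "a = of_nat n" by blast
  moreover have "of_nat n ^ p = (of_nat n :: 'a)"
  proof (induction n)
    case 0
    then show ?case using p_ge_2 by simp
  next
    case (Suc n)
    have "(1 + of_nat n :: 'a) ^ p = 1 ^ p + of_nat n ^ p"
      by (rule freshmans_dream) (simp_all only: CHAR_eq_p prime_p)
    then show ?case by (simp only: Suc of_nat_Suc power_one)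
  qed
  ultimately show ?thesis by simp
qed

section \<open>Frobenius and the substitution of t^p\<close>

abbreviation infl :: "'a fps \<Rightarrow> 'a fps" where
  "infl u \<equiv> u oo fps_X ^ p"

lemma infl_nth: "fps_nth (infl u) n = (if p dvd n then fps_nth u (n div p) else 0)"
  using p_ge_2 by (simp add: fps_nth_compose_X_power)

lemma X_power_p_nth_0: "fps_nth (fps_X ^ p :: 'a fps) 0 = 0"
  using p_ge_2 by simp

lemma infl_mult: "infl (u * v) = infl u * infl v"
  by (rule fps_compose_mult_distrib[OF X_power_p_nth_0])

lemma infl_X: "infl fps_X = fps_X ^ p"
  using X_power_p_nth_0 by (rule fps_X_fps_compose_startby0)

lemma infl_X_power: "infl (fps_X ^ n) = fps_X ^ (p * n)"
  using fps_compose_power[OF X_power_p_nth_0, of fps_X n]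
  by (simp add: infl_X power_mult)

lemma X_power_dvd_infl:
  assumes "fps_X ^ n dvd u" "k \<le> p * n"
  shows "fps_X ^ k dvd infl u"
proof -
  obtain v where "u = fps_X ^ n * v" using assms(1) by (rule dvdE)
  then have "fps_X ^ (p * n) dvd infl u" by (simp add: infl_mult infl_X_power)
  then show ?thesis using assms(2) by (rule fps_X_power_dvd_weaken)
qed

text \<open>Additivity of the \<open>p\<close>-th power covers only finite sums, so one constant
  term is peeled off and strong induction on the coefficient index treats the tail.\<close>

lemma frobenius: "u ^ p = infl u"
proof (rule fps_ext)
  fix n
  show "fps_nth (u ^ p) n = fps_nth (infl u) n"
  proof (induction n arbitrary: u rule: less_induct)
    case (less n)
    define v where "v = fps_shift 1 u"
    have u: "u = fps_const (fps_nth u 0) + fps_X * v"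
      unfolding v_def by (intro fps_ext) (simp add: fps_X_mult_nth)
    have "u ^ p = fps_const (fps_nth u 0 ^ p) + fps_X ^ p * v ^ p"
      by (subst u, subst freshmans_dream)
         (use prime_p in \<open>simp_all add: CHAR_eq_p power_mult_distrib fps_const_power\<close>)
    then have up: "u ^ p = fps_const (fps_nth u 0) + fps_X ^ p * v ^ p"
      by (simp add: fermat)
    have iu: "infl u = fps_const (fps_nth u 0) + fps_X ^ p * infl v"
      by (subst u) (simp add: fps_compose_add_distrib infl_mult infl_X)
    show ?case
    proof (cases "n < p")
      case True
      then show ?thesis unfolding up iu by (simp add: fps_X_power_mult_nth)
    next
      case False
      then have "fps_nth (v ^ p) (n - p) = fps_nth (infl v) (n - p)"
        using less[of "n - p" v] p_ge_2 by simp
      then show ?thesis unfolding up iu using False by (simp add: fps_X_power_mult_nth)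
    qed
  qed
qed

text \<open>By the Frobenius identity, a series without constant term commutes with t^p under
  substitution; this is why affine maps compose to affine maps.\<close>

lemma infl_compose:
  assumes "fps_nth g 0 = 0"
  shows "infl u oo g = infl (u oo g)"
proof -
  have "infl u oo g = u oo (fps_X ^ p oo g)"
    by (rule fps_compose_assoc[symmetric]) (use assms X_power_p_nth_0 in auto)
  also have "fps_X ^ p oo g = g oo fps_X ^ p"
    using assms frobenius[of g] by (simp flip: fps_compose_power)
  also have "u oo (g oo fps_X ^ p) = infl (u oo g)"
    by (rule fps_compose_assoc) (use assms X_power_p_nth_0 in auto)
  finally show ?thesis .
qed

section \<open>The group of affine maps\<close>

definition aff :: "'a fps \<Rightarrow> 'a fps \<Rightarrow> 'a fps" where
  "aff A B = infl A * fps_X + infl B"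

lemma aff_nth_mult: "fps_nth (aff A B) (p * n) = fps_nth B n"
proof (cases "p * n = 0")
  case True
  then show ?thesis using p_ge_2 by (simp add: aff_def)
next
  case False
  \<comment> \<open>Consecutive numbers are not both multiples of \<open>p\<close>, so the linear
    part contributes nothing at index \<open>p * n\<close>.\<close>
  have "coprime (p * n) (p * n - 1)"
    using False coprime_diff_one_right_nat[of "p * n"] by simp
  then have "\<not> p dvd p * n - 1"
    using p_ge_2 coprime_common_divisor[of "p * n" "p * n - 1" p] by auto
  then show ?thesis using False p_ge_2 by (simp add: aff_def infl_nth)
qed

lemma aff_nth_mult_Suc: "fps_nth (aff A B) (Suc (p * n)) = fps_nth A n"
proof -
  have "\<not> p dvd Suc (p * n)"
    using p_ge_2 dvd_add_right_iff[of p "p * n" 1] by simp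
  then show ?thesis using p_ge_2 by (simp add: aff_def infl_nth)
qed

lemma aff_nth_eq_0:
  assumes "\<not> p dvd n" "\<not> p dvd n - 1"
  shows "fps_nth (aff A B) n = 0"
proof -
  have "n \<noteq> 0" using assms(1) by (metis dvd_0_right)
  then show ?thesis using assms by (simp add: aff_def infl_nth)
qed

lemma aff_inject:
  assumes "aff A B = aff C D"
  shows "A = C" "B = D"
proof -
  show "A = C"
    by (rule fps_ext) (use assms aff_nth_mult_Suc[of A B] aff_nth_mult_Suc[of C D] in metis)
  show "B = D"
    by (rule fps_ext) (use assms aff_nth_mult[of A B] aff_nth_mult[of C D] in metis)
qed

lemma aff_in_S:
  assumes "fps_nth A 0 = 1" "fps_nth B 0 = 0"
  shows "aff A B \<in> S_set p"
proof -
  have "aff A B \<in> carrier Nott"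
    using assms aff_nth_mult[of A B 0] aff_nth_mult_Suc[of A B 0] by (simp add: Nott_carrier_iff)
  then show ?thesis
    unfolding S_set_def using aff_nth_eq_0 by blast
qed

lemma S_affE:
  assumes "f \<in> S_set p"
  obtains A B where "f = aff A B" "fps_nth A 0 = 1" "fps_nth B 0 = 0"
proof
  define A where "A = Abs_fps (\<lambda>n. fps_nth f (Suc (p * n)))"
  define B where "B = Abs_fps (\<lambda>n. fps_nth f (p * n))"
  show "f = aff A B"
  proof (rule fps_ext)
    fix n
    show "fps_nth f n = fps_nth (aff A B) n"
    proof (cases "p dvd n")
      case True
      then show ?thesis by (auto simp: aff_nth_mult B_def)
    next
      case False
      then have "n \<noteq> 0" by (metis dvd_0_right)
      show ?thesis
      proof (cases "p dvd n - 1")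
        case True
        then obtain k where "n - 1 = p * k" by (rule dvdE)
        then have "n = Suc (p * k)" using \<open>n \<noteq> 0\<close> by simp
        then show ?thesis by (simp only: aff_nth_mult_Suc) (simp add: A_def)
      next
        case 2: False
        then have "n \<noteq> 1" by auto
        then have "fps_nth f n = 0"
          using assms \<open>n \<noteq> 0\<close> False 2
          by (auto simp: S_set_def dest!: spec[of _ n])
        then show ?thesis using aff_nth_eq_0[OF False 2] by simp
      qed
    qed
  qed
  show "fps_nth A 0 = 1" "fps_nth B 0 = 0"
    using assms by (simp_all add: A_def B_def S_set_def Nott_carrier_iff)
qed

lemma aff_compose:
  assumes "fps_nth (aff A B) 0 = 0"
  shows "aff C D oo aff A B =
    aff ((C oo aff A B) * A) ((C oo aff A B) * B + (D oo aff A B))"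
proof -
  define g where "g = aff A B"
  have g: "fps_nth g 0 = 0" using assms by (simp add: g_def)
  have "aff C D oo g = infl (C oo g) * g + infl (D oo g)"
    by (simp add: aff_def fps_compose_add_distrib fps_compose_mult_distrib[OF g]
        infl_compose[OF g] g)
  also have "\<dots> = aff ((C oo g) * A) ((C oo g) * B + (D oo g))"
    by (subst g_def) (simp add: aff_def infl_mult fps_compose_add_distrib algebra_simps)
  finally show ?thesis by (simp add: g_def)
qed

lemma S_subset_Nott: "S_set p \<subseteq> carrier Nott"
  by (auto simp: S_set_def)

lemma aff_in_Nott: "fps_nth A 0 = 1 \<Longrightarrow> fps_nth B 0 = 0 \<Longrightarrow> aff A B \<in> carrier Nott"
  using aff_in_S S_subset_Nott by blast

lemma S_compose:
  assumes "f \<in> S_set p" "g \<in> S_set p"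
  shows "f oo (g :: 'a fps) \<in> S_set p"
proof -
  obtain C D where f: "f = aff C D" "fps_nth C 0 = 1" "fps_nth D 0 = 0"
    using assms(1) by (rule S_affE)
  obtain A B where g: "g = aff A B" "fps_nth A 0 = 1" "fps_nth B 0 = 0"
    using assms(2) by (rule S_affE)
  have "fps_nth (aff A B) 0 = 0"
    using g aff_nth_mult[of A B 0] by simp
  then show ?thesis
    unfolding f(1) g(1) by (subst aff_compose) (use f g in \<open>auto intro: aff_in_S\<close>)
qed

text \<open>In \<open>f oo g = fps_X\<close> the unknown \<open>g\<close> occurs linearly once
  \<open>C oo g\<close> and \<open>D oo g\<close> are regarded as given; dividing by the inflated
  unit \<open>C oo g\<close> exhibits \<open>g\<close> as affine.\<close>

lemma S_fps_inv:
  assumes "f \<in> S_set p"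
  shows "fps_inv f \<in> (S_set p :: 'a fps set)"
proof -
  obtain C D where f: "f = aff C D" "fps_nth C 0 = 1" "fps_nth D 0 = 0"
    using assms by (rule S_affE)
  define g where "g = fps_inv f"
  have fN: "f \<in> carrier Nott" using assms S_subset_Nott by blast
  have g0: "fps_nth g 0 = 0"
    using fps_inv_in_Nott[OF fN] by (simp add: g_def Nott_carrier_iff)
  define A where "A = inverse (C oo g)"
  have "A * (C oo g) = 1"
    unfolding A_def by (rule inverse_mult_eq_1) (simp add: f)
  then have AC: "infl A * infl (C oo g) = 1" by (metis infl_mult fps_compose_1)
  have "infl (C oo g) * g + infl (D oo g) = f oo g"
    by (simp add: f(1) aff_def fps_compose_add_distrib fps_compose_mult_distrib[OF g0]
        infl_compose[OF g0] g0)
  also have "\<dots> = fps_X" by (simp add: g_def compose_fps_inv[OF fN])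
  finally have "infl (C oo g) * g = fps_X - infl (D oo g)"
    by (simp add: eq_diff_eq)
  then have "infl A * (infl (C oo g) * g) = infl A * (fps_X - infl (D oo g))"
    by simp
  then have "g = infl A * (fps_X - infl (D oo g))"
    using AC by (simp flip: mult.assoc)
  also have "\<dots> = aff A (- (A * (D oo g)))"
    by (simp add: aff_def infl_mult fps_compose_uminus algebra_simps)
  finally have "g = aff A (- (A * (D oo g)))" .
  moreover have "aff A (- (A * (D oo g))) \<in> S_set p"
    by (rule aff_in_S) (simp_all add: A_def f)
  ultimately show ?thesis by (simp add: g_def)
qed

lemma X_in_S: "(fps_X :: 'a fps) \<in> S_set p"
  by (auto simp: S_set_def Nott_carrier_iff)

lemma S_subgroup: "subgroup (S_set p :: 'a fps set) Nott"
proof (rule group.subgroupI[OF group_Nott])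
  show "S_set p \<noteq> ({} :: 'a fps set)" using X_in_S by blast
next
  fix f :: "'a fps" assume "f \<in> S_set p"
  moreover from this have "f \<in> carrier Nott" using S_subset_Nott by blast
  ultimately show "inv\<^bsub>Nott\<^esub> f \<in> S_set p" by (simp add: Nott_inv S_fps_inv)
qed (simp_all add: S_subset_Nott S_compose Nott_mult)

section \<open>Depth of an element read off its coordinates\<close>

lemma X_power_dvd_infl_minus_1_mult_X:
  assumes "fps_X ^ n dvd A - 1" "k \<le> p * n + 1"
  shows "fps_X ^ k dvd (infl A - 1) * fps_X"
proof -
  have "infl A - 1 = infl (A - 1)" by (simp add: fps_compose_sub_distrib)
  then have "fps_X ^ (p * n) dvd infl A - 1" using X_power_dvd_infl[OF assms(1)] by simp
  then show ?thesis by (rule fps_X_power_dvd_mult[of _ _ 1]) (use assms(2) in simp_all)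
qed

lemma aff_minus_X: "aff A B - fps_X = (infl A - 1) * fps_X + infl B"
  by (simp add: aff_def algebra_simps)

lemma aff_minus_X_dvd:
  assumes "fps_X ^ m dvd A - 1" "fps_X ^ n dvd B" "k \<le> p * m + 1" "k \<le> p * n"
  shows "fps_X ^ k dvd aff A B - fps_X"
  unfolding aff_minus_X
  by (intro dvd_add X_power_dvd_infl_minus_1_mult_X X_power_dvd_infl) (use assms in auto)

text \<open>The linear part enters one order later than the translation part, so it suffices that
  \<open>P - 1\<close> vanishes to the same order \<open>n\<close>.\<close>

lemma translation_depth:
  assumes "fps_X ^ n dvd P - 1" "fps_X ^ Suc n dvd Q - fps_const b * fps_X ^ n"
  shows "fps_X ^ Suc (p * n) dvd aff P Q - fps_X - fps_const b * fps_X ^ (p * n)"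
proof -
  have "infl (Q - fps_const b * fps_X ^ n) = infl Q - fps_const b * fps_X ^ (p * n)"
    by (simp add: fps_compose_sub_distrib infl_mult infl_X_power)
  then have e: "aff P Q - fps_X - fps_const b * fps_X ^ (p * n) =
      (infl P - 1) * fps_X + infl (Q - fps_const b * fps_X ^ n)"
    by (simp add: aff_minus_X)
  show ?thesis unfolding e
    by (intro dvd_add X_power_dvd_infl_minus_1_mult_X[OF assms(1)] X_power_dvd_infl[OF assms(2)])
       (use p_ge_2 in simp_all)
qed

text \<open>Inflation makes the contribution of \<open>Q\<close> start at \<open>p * n + p\<close>,
  which \<open>p \<ge> 2\<close> puts past the exponent \<open>Suc (p * n)\<close>.\<close>

lemma linear_depth:
  assumes "fps_X ^ Suc n dvd P - 1 - fps_const a * fps_X ^ n" "fps_X ^ Suc n dvd Q"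
  shows "fps_X ^ (p * n + 2) dvd aff P Q - fps_X - fps_const a * fps_X ^ Suc (p * n)"
proof -
  have e1: "infl (P - 1 - fps_const a * fps_X ^ n) = infl P - 1 - fps_const a * fps_X ^ (p * n)"
    by (simp add: fps_compose_sub_distrib infl_mult infl_X_power)
  have e: "aff P Q - fps_X - fps_const a * fps_X ^ Suc (p * n) =
      infl (P - 1 - fps_const a * fps_X ^ n) * fps_X + infl Q"
    unfolding e1 aff_minus_X by (simp add: algebra_simps)
  show ?thesis unfolding e
    by (intro dvd_add dvd_mult2 X_power_dvd_infl[OF assms(1)] X_power_dvd_infl[OF assms(2)])
       (use p_ge_2 in simp_all)
qed

section \<open>Finite index and pro-p\<close>

lemma S_infinite: "infinite (S_set p :: 'a fps set)"
proof -
  define \<phi> where "\<phi> k = aff 1 (fps_X ^ Suc k)" for k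
  have "inj \<phi>"
  proof (rule injI)
    fix k l assume "\<phi> k = \<phi> l"
    then have "fps_nth (fps_X ^ Suc k :: 'a fps) (Suc k) = fps_nth (fps_X ^ Suc l) (Suc k)"
      using aff_inject(2) by (metis \<phi>_def)
    then show "k = l" by (simp del: power_Suc split: if_splits)
  qed
  moreover have "range \<phi> \<subseteq> S_set p" by (auto simp: \<phi>_def intro!: aff_in_S)
  ultimately show ?thesis using infinite_super range_inj_infinite by blast
qed

lemma S_closed: "nott_closed (carrier Nott) (S_set p :: 'a fps set)"
  unfolding nott_closed_def nott_open_def
proof (intro conjI ballI)
  fix f :: "'a fps" assume "f \<in> carrier Nott - S_set p"
  then obtain n where n: "n \<ge> 2" "fps_nth f n \<noteq> 0" "\<not> p dvd n" "\<not> p dvd n - 1"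
    by (auto simp: S_set_def)
  have "g \<in> carrier Nott - S_set p" if "g \<in> carrier Nott" "agree_mod (Suc n) g f" for g
  proof -
    have "fps_nth g n \<noteq> 0" using that(2) n(2) by (simp add: agree_mod_def)
    then show ?thesis using that(1) n by (auto simp: S_set_def)
  qed
  then show "\<exists>n. \<forall>g\<in>carrier Nott. agree_mod n g f \<longrightarrow> g \<in> carrier Nott - S_set p" by blast
qed (use S_subset_Nott in auto)

text \<open>The coefficients at admissible indices from \<open>2\<close> up to \<open>n - 1\<close>
  are free and determine the truncation, so restriction to them is a bijection onto a function space
  over the field.\<close>

lemma card_S_truncations:
  "card (fps_cutoff n ` (S_set p :: 'a fps set)) = p ^ card {k. 2 \<le> k \<and> k < n \<and> (p dvd k \<or> p dvd k - 1)}"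
proof -
  define I where "I = {k. 2 \<le> k \<and> k < n \<and> (p dvd k \<or> p dvd k - 1)}"
  have fin: "finite I" by (rule finite_subset[of _ "{..<n}"]) (auto simp: I_def)
  have "bij_betw (\<lambda>f. restrict (fps_nth f) I) (fps_cutoff n ` (S_set p :: 'a fps set))
      (I \<rightarrow>\<^sub>E (UNIV :: 'a set))"
    unfolding bij_betw_def
  proof
    show "inj_on (\<lambda>f. restrict (fps_nth f) I) (fps_cutoff n ` (S_set p :: 'a fps set))"
    proof (rule inj_onI, clarify)
      fix f g :: "'a fps"
      assume f: "f \<in> S_set p" and g: "g \<in> S_set p"
        and eq: "restrict (fps_nth (fps_cutoff n f)) I = restrict (fps_nth (fps_cutoff n g)) I"
      have "fps_nth f k = fps_nth g k" if "k < n" for k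
      proof (cases "k \<in> I")
        case True
        then show ?thesis using fun_cong[OF eq, of k] that by simp
      next
        case False
        then consider "k = 0" | "k = 1" | "k \<ge> 2" "\<not> p dvd k" "\<not> p dvd k - 1"
          using \<open>k < n\<close> less_2_cases[of k] unfolding I_def by (cases "k \<ge> 2") auto
        moreover have "f \<in> carrier Nott" "g \<in> carrier Nott" using f g S_subset_Nott by auto
        ultimately show ?thesis
          by cases (use f g in \<open>auto simp: S_set_nth_eq_0 Nott_carrier_iff\<close>)
      qed
      then show "fps_cutoff n f = fps_cutoff n g" by (intro fps_ext) simp
    qed
    show "(\<lambda>f. restrict (fps_nth f) I) ` fps_cutoff n ` (S_set p :: 'a fps set) = (I \<rightarrow>\<^sub>E UNIV)"
    proof (intro equalityI subsetI)
      fix h :: "nat \<Rightarrow> 'a" assume h: "h \<in> I \<rightarrow>\<^sub>E UNIV"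
      define f where "f = Abs_fps (\<lambda>k. if k = 1 then 1 else if k \<in> I then h k else 0)"
      have "f \<in> S_set p" by (auto simp: f_def S_set_def Nott_carrier_iff I_def)
      moreover have "restrict (fps_nth (fps_cutoff n f)) I = h"
      proof
        fix k
        show "restrict (fps_nth (fps_cutoff n f)) I k = h k"
          using PiE_arb[OF h, of k] by (cases "k \<in> I") (auto simp: f_def I_def)
      qed
      ultimately show "h \<in> (\<lambda>f. restrict (fps_nth f) I) ` fps_cutoff n ` S_set p" by blast
    qed auto
  qed
  then have "card (fps_cutoff n ` (S_set p :: 'a fps set)) = card (I \<rightarrow>\<^sub>E (UNIV :: 'a set))"
    by (rule bij_betw_same_card)
  also have "\<dots> = p ^ card I" using fin by (simp add: card_PiE card_field)
  finally show ?thesis by (simp add: I_def)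
qed

text \<open>The truncations modulo \<open>X\<^sup>n\<close> of the cosets of \<open>U\<close> partition the truncations of \<open>S\<close>
  into blocks of equal size as soon as \<open>U\<close> contains all series congruent to \<open>X\<close>.\<close>

lemma index_prime_power:
  assumes U: "subgroup U (Nott\<lparr>carrier := S_set p\<rparr>)" and U_open: "nott_open (S_set p) U"
  shows "\<exists>e. card (rcosets\<^bsub>Nott\<lparr>carrier := S_set p :: 'a fps set\<rparr>\<^esub> U) = p ^ e"
proof -
  define G where "G = Nott\<lparr>carrier := S_set p :: 'a fps set\<rparr>"
  have G: "group G" unfolding G_def by (rule group.subgroup_imp_group[OF group_Nott S_subgroup])
  have UG: "subgroup U G" using U by (simp add: G_def)
  have mult: "x \<otimes>\<^bsub>G\<^esub> y = x oo y" for x y by (simp add: G_def Nott_mult)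
  have car: "carrier G = S_set p" by (simp add: G_def)
  have US: "U \<subseteq> S_set p" using subgroup.subset[OF UG] car by simp
  have "fps_X \<in> U" using subgroup.one_closed[OF U] by (simp add: Nott_one)
  then obtain n where n: "\<And>g. g \<in> S_set p \<Longrightarrow> fps_X ^ n dvd g - fps_X \<Longrightarrow> g \<in> U"
    using U_open unfolding nott_open_def agree_mod_iff_dvd by blast
  have cut: "fps_cutoff n x = fps_cutoff n y \<longleftrightarrow> fps_X ^ n dvd x - y" for x y :: "'a fps"
    by (simp add: fps_cutoff_eq_fps_cutoff_iff fps_X_power_dvd_iff)
  define coset where "coset f = U #>\<^bsub>G\<^esub> f" for f
  have coset: "coset f = (\<lambda>u. u oo f) ` U" for f
    by (auto simp: coset_def r_coset_def mult)
  have R: "rcosets\<^bsub>G\<^esub> U = coset ` S_set p" by (auto simp: RCOSETS_def coset_def car)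
  have repr: "coset f = coset x" if "f \<in> S_set p" "x \<in> coset f" for f x
    using group.repr_independence[OF G] that UG car by (auto simp: coset_def)
  have coset_S: "coset f \<subseteq> S_set p" if "f \<in> S_set p" for f
    using that US S_compose by (auto simp: coset)
  have self: "f \<in> coset f" if "f \<in> S_set p" for f
    using group.rcos_self[OF G _ UG] that car by (simp add: coset_def)
  \<comment> \<open>Elements with equal truncations differ by a factor congruent to
    \<open>fps_X\<close>, which lies in \<open>U\<close>; hence cosets sharing a truncation
    coincide.\<close>
  have meet: "coset f = coset f'"
    if f: "f \<in> S_set p" "f' \<in> S_set p" and xy: "x \<in> coset f" "y \<in> coset f'" "fps_cutoff n x = fps_cutoff n y"
    for f f' x y
  proof -
    have S: "x \<in> S_set p" "y \<in> S_set p" using coset_S f xy by auto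
    then have xN: "x \<in> carrier Nott" using S_subset_Nott by blast
    have "fps_X ^ n dvd y - x" using xy(3) cut by metis
    then have "fps_X ^ n dvd (y - x) oo fps_inv x"
      by (simp add: fps_X_power_dvd_compose_iff[OF fps_inv_in_Nott[OF xN]])
    then have "fps_X ^ n dvd (y oo fps_inv x) - fps_X"
      by (simp add: fps_compose_sub_distrib compose_fps_inv[OF xN])
    then have "y oo fps_inv x \<in> U" by (intro n S_compose S_fps_inv S)
    then have "(y oo fps_inv x) oo x \<in> coset x" unfolding coset by blast
    then have "y \<in> coset x" by (simp add: compose_fps_inv_cancel[OF xN])
    then show ?thesis using repr S f xy by metis
  qed
  define \<C> where "\<C> = (\<lambda>c. fps_cutoff n ` c) ` (rcosets\<^bsub>G\<^esub> U)"
  have Un: "\<Union>\<C> = fps_cutoff n ` S_set p"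
    unfolding \<C>_def R using coset_S self by blast
  have "card (fps_cutoff n ` (S_set p :: 'a fps set)) \<noteq> 0"
    unfolding card_S_truncations using p_ge_2 by simp
  then have finT: "finite (fps_cutoff n ` (S_set p :: 'a fps set))" by (meson card.infinite)
  have inj: "inj_on (\<lambda>c. fps_cutoff n ` c) (rcosets\<^bsub>G\<^esub> U)"
  proof (rule inj_onI)
    fix c d assume "c \<in> rcosets\<^bsub>G\<^esub> U" "d \<in> rcosets\<^bsub>G\<^esub> U" and e: "fps_cutoff n ` c = fps_cutoff n ` d"
    then obtain f f' where f: "c = coset f" "d = coset f'" "f \<in> S_set p" "f' \<in> S_set p"
      unfolding R by blast
    have "fps_cutoff n f \<in> fps_cutoff n ` d" using self f e by blast
    then obtain y where "y \<in> d" "fps_cutoff n f = fps_cutoff n y" by blast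
    then show "c = d" using meet[of f f' f y] f self by blast
  qed
  have "card (fps_cutoff n ` U) * card \<C> = card (\<Union>\<C>)"
  proof (rule card_partition)
    show "finite (\<Union>\<C>)" using finT by (simp only: Un)
    then show "finite \<C>" by (rule finite_UnionD)
  next
    fix c assume "c \<in> \<C>"
    then obtain f where f: "c = fps_cutoff n ` coset f" "f \<in> S_set p" unfolding \<C>_def R by blast
    then have fN: "f \<in> carrier Nott" using S_subset_Nott by blast
    \<comment> \<open>Right composition with \<open>f\<close> preserves and reflects congruence
      modulo \<open>fps_X ^ n\<close>, so every block has the size of the block of
      \<open>U\<close>.\<close>
    have "card ((\<lambda>u. fps_cutoff n (u oo f)) ` U) = card (fps_cutoff n ` U)"
    proof (rule card_image_cong_kernel)
      fix u v
      show "fps_cutoff n (u oo f) = fps_cutoff n (v oo f) \<longleftrightarrow> fps_cutoff n u = fps_cutoff n v"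
        using fps_X_power_dvd_compose_iff[OF fN, of n "u - v"] by (simp add: cut fps_compose_sub_distrib)
    qed
    then show "card c = card (fps_cutoff n ` U)" by (simp add: f(1) coset image_image)
  next
    fix c d assume "c \<in> \<C>" "d \<in> \<C>" "c \<noteq> d"
    then obtain f f' where f: "c = fps_cutoff n ` coset f" "d = fps_cutoff n ` coset f'"
      "f \<in> S_set p" "f' \<in> S_set p" unfolding \<C>_def R by blast
    show "c \<inter> d = {}"
    proof (rule ccontr)
      assume "c \<inter> d \<noteq> {}"
      then obtain z where z: "z \<in> fps_cutoff n ` coset f" "z \<in> fps_cutoff n ` coset f'"
        using f(1,2) by auto
      obtain x where x: "x \<in> coset f" "z = fps_cutoff n x" using z(1) by (rule imageE)
      obtain y where y: "y \<in> coset f'" "z = fps_cutoff n y" using z(2) by (rule imageE)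
      have "coset f = coset f'" using meet[OF f(3,4) x(1) y(1)] x(2) y(2) by simp
      then show False using f \<open>c \<noteq> d\<close> by simp
    qed
  qed
  then have "card \<C> dvd card (fps_cutoff n ` (S_set p :: 'a fps set))"
    unfolding Un by (metis dvd_triv_right)
  moreover have "card \<C> = card (rcosets\<^bsub>G\<^esub> U)" unfolding \<C>_def by (rule card_image[OF inj])
  ultimately have "card (rcosets\<^bsub>G\<^esub> U) dvd p ^ card {k. 2 \<le> k \<and> k < n \<and> (p dvd k \<or> p dvd k - 1)}"
    unfolding card_S_truncations by simp
  then show ?thesis using divides_primepow_nat[OF prime_p] by (auto simp: G_def)
qed

lemma S_pro_p: "nott_pro_p p (S_set p :: 'a fps set)"
  unfolding nott_pro_p_def using S_subgroup S_closed index_prime_power normal_imp_subgroup by blast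

section \<open>An element of order p\<close>

text \<open>The substitution \<open>t \<mapsto> t (1 + t\<^bsup>p-1\<^esup>)\<^bsup>-1/(p-1)\<^esup>\<close> becomes the translation \<open>s \<mapsto> s + 1\<close> in the
  variable \<open>s = t\<^bsup>1-p\<^esup>\<close>, hence has order \<open>p\<close>. By the product
  \<open>(1 + y)\<^bsup>-1/(p-1)\<^esup> = \<Prod>\<^sub>i (1 + y\<^bsup>p^i\<^esup>)\<close> its coefficients detect the exponents all of whose digits
  in base \<open>p\<close> are \<open>0\<close> or \<open>p - 1\<close>.\<close>

definition W :: "'a fps" where
  "W = Abs_fps (\<lambda>n. if extremal_digits p n then 1 else 0)"

lemma W_0: "fps_nth W 0 = 1"
  by (simp add: W_def extremal_digits.simps)

lemma W_digits:
  assumes "r < p"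
  shows "fps_nth W (p * q + r) = (if r = 0 \<or> r = p - 1 then fps_nth W q else 0)"
proof (cases "p * q + r = 0")
  case True
  then show ?thesis using p_ge_2 by auto
next
  case False
  have "(p * q + r) mod p = r" "(p * q + r) div p = q" using assms p_ge_2 by simp_all
  then have "extremal_digits p (p * q + r) \<longleftrightarrow> (r = 0 \<or> r = p - 1) \<and> extremal_digits p q"
    using False p_ge_2 extremal_digits.simps[of p "p * q + r"] by auto
  then show ?thesis by (simp add: W_def)
qed

text \<open>Splitting off the last digit: digit \<open>0\<close> gives \<open>infl W\<close>, digit
  \<open>p - 1\<close> gives its shift, and the two cases are disjoint because
  \<open>p \<ge> 2\<close>.\<close>

lemma W_eq: "W = infl W * (1 + fps_X ^ (p - 1))"
proof (rule fps_ext)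
  fix n
  define q r where "q = n div p" and "r = n mod p"
  have n: "n = p * q + r" and r: "r < p" using p_ge_2 by (simp_all add: q_def r_def)
  have infl: "fps_nth (infl W) n = (if r = 0 then fps_nth W q else 0)"
    by (simp add: infl_nth q_def r_def dvd_eq_mod_eq_0)
  have shift: "fps_nth (infl W * fps_X ^ (p - 1)) n = (if r = p - 1 then fps_nth W q else 0)"
  proof (cases "r = p - 1")
    case True
    then have "n - (p - 1) = p * q" "\<not> n < p - 1" by (simp_all add: n)
    then show ?thesis using True p_ge_2 by (simp add: fps_X_power_mult_right_nth infl_nth)
  next
    case False
    have "\<not> p dvd n - (p - 1)" if "n \<ge> p - 1"
    proof
      assume "p dvd n - (p - 1)"
      then have "p dvd n - (p - 1) + p" by simp
      moreover have "n - (p - 1) + p = Suc n" using that p_ge_2 by simp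
      ultimately have "Suc n mod p = 0" by simp
      moreover have "Suc n mod p = Suc r"
        using False r by (simp add: mod_Suc r_def)
      ultimately show False by simp
    qed
    then show ?thesis using False by (simp add: fps_X_power_mult_right_nth infl_nth)
  qed
  have "fps_nth (infl W * (1 + fps_X ^ (p - 1))) n =
      (if r = 0 then fps_nth W q else 0) + (if r = p - 1 then fps_nth W q else 0)"
    by (simp add: distrib_left infl shift del: One_nat_def)
  also have "\<dots> = fps_nth W n"
    unfolding n W_digits[OF r] using p_ge_2 by auto
  finally show "fps_nth W n = fps_nth (infl W * (1 + fps_X ^ (p - 1))) n" ..
qed

text \<open>Frobenius turns the functional equation into
  \<open>W = W ^ p * (1 + fps_X ^ (p - 1))\<close>, from which one factor \<open>W\<close> is
  cancelled.\<close>

lemma W_power: "W ^ (p - 1) * (1 + fps_X ^ (p - 1)) = 1"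
proof -
  have "W * (W ^ (p - 1) * (1 + fps_X ^ (p - 1))) = W ^ p * (1 + fps_X ^ (p - 1))"
    using p_ge_2 power_Suc[of W "p - 1"] by (simp add: mult.assoc)
  also have "\<dots> = W * 1" by (simp only: frobenius[of W] mult_1_right W_eq[symmetric])
  finally have "W * (W ^ (p - 1) * (1 + fps_X ^ (p - 1))) = W * 1" .
  moreover have "W \<noteq> 0" using W_0 by auto
  ultimately show ?thesis by (simp only: mult_cancel_left simp_thms)
qed

text \<open>Exponents in \<open>W\<close> end in the digit \<open>0\<close> or \<open>p - 1\<close>;
  multiplication by \<open>fps_X\<close> moves them to the residues \<open>1\<close> and
  \<open>0\<close> modulo \<open>p\<close>.\<close>

lemma X_W_in_S: "fps_X * W \<in> S_set p"
proof -
  have "p dvd n \<or> p dvd n - 1" if n: "n \<ge> 2" "fps_nth (fps_X * W) n \<noteq> 0" for n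
  proof -
    define q r where "q = (n - 1) div p" and "r = (n - 1) mod p"
    have n1: "n - 1 = p * q + r" and r: "r < p" using p_ge_2 by (simp_all add: q_def r_def)
    have "fps_nth W (p * q + r) \<noteq> 0" using n n1 by simp
    then have "r = 0 \<or> r = p - 1" using W_digits[OF r, of q] by metis
    then show ?thesis
    proof
      assume "r = 0"
      then show ?thesis using n1 by simp
    next
      assume "r = p - 1"
      then have "n = p * q + p" using n1 n(1) p_ge_2 by simp
      then show ?thesis by simp
    qed
  qed
  then show ?thesis by (simp add: S_set_def Nott_carrier_iff W_0)
qed

lemma X_W_neq_X: "fps_X * W \<noteq> fps_X"
proof
  assume "fps_X * W = fps_X"
  then have "fps_nth (fps_X * W) p = fps_nth fps_X p" by simp
  moreover have "fps_nth W (p - 1) = 1" using W_digits[of "p - 1" 0] p_ge_2 W_0 by simp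
  ultimately show False using p_ge_2 by simp
qed

text \<open>Roots of order \<open>p - 1\<close> with prescribed leading coefficient are unique: the
  cofactor of \<open>v - 1\<close> in \<open>v ^ (p - 1) - 1\<close> has the invertible constant
  term \<open>p - 1\<close>.\<close>

lemma Nott_eq_X_if_power_eq:
  assumes h: "h \<in> carrier Nott" "h ^ (p - 1) = fps_X ^ (p - 1)"
  shows "h = (fps_X :: 'a fps)"
proof -
  have "fps_X dvd h" using h(1) by (simp add: fps_X_dvd_iff Nott_carrier_iff)
  then obtain v where v: "h = fps_X * v" by (rule dvdE)
  have v0: "fps_nth v 0 = 1" using h(1) by (simp add: v Nott_carrier_iff)
  have "v ^ (p - 1) = 1" using h(2) by (simp add: v power_mult_distrib)
  then have "(v - 1) * (\<Sum>i<p-1. v ^ i) = 0" by (simp flip: power_diff_1_eq)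
  moreover have "fps_nth (\<Sum>i<p-1. v ^ i) 0 = of_nat (p - 1)"
    by (simp add: fps_sum_nth v0 fps_power_zeroth)
  moreover have "of_nat (p - 1) \<noteq> (0 :: 'a)"
    unfolding of_nat_eq_0_iff_p_dvd using p_ge_2 by (simp add: nat_dvd_not_less)
  ultimately have "v - 1 = 0" by (metis fps_zero_nth mult_eq_0_iff)
  then show ?thesis by (simp add: v)
qed

lemma X_W_finite_order: "(fps_X * W) [^]\<^bsub>Nott\<^esub> p = fps_X"
proof -
  define f where "f = fps_X * W"
  have f: "f \<in> carrier Nott" using X_W_in_S S_subset_Nott by (auto simp: f_def)
  then have f0: "fps_nth f 0 = 0" by (simp add: Nott_carrier_iff)
  have fp: "f ^ (p - 1) * (1 + fps_X ^ (p - 1)) = fps_X ^ (p - 1)"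
    using W_power by (simp add: f_def power_mult_distrib mult.assoc)
  interpret group "Nott :: 'a fps monoid" by (rule group_Nott)
  \<comment> \<open>With denominators cleared, this says that the \<open>i\<close>-th iterate sends
    s = t^(1-p) to s + i; at \<open>i = p\<close> the shift vanishes.\<close>
  have "(f [^]\<^bsub>Nott\<^esub> i) ^ (p - 1) * (1 + of_nat i * fps_X ^ (p - 1)) = fps_X ^ (p - 1)" for i :: nat
  proof (induction i)
    case 0
    then show ?case by (simp add: Nott_one)
  next
    case (Suc i)
    define h where "h = f [^]\<^bsub>Nott\<^esub> i"
    have hf: "f [^]\<^bsub>Nott\<^esub> Suc i = h oo f" by (simp add: h_def Nott_mult)
    have "(h ^ (p - 1) * (1 + of_nat i * fps_X ^ (p - 1))) oo f = fps_X ^ (p - 1) oo f"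
      using Suc by (simp add: h_def)
    moreover have "of_nat i oo f = (of_nat i :: 'a fps)"
      by (simp flip: fps_of_nat)
    ultimately have *: "(h oo f) ^ (p - 1) * (1 + of_nat i * f ^ (p - 1)) = f ^ (p - 1)"
      using f0 by (simp add: fps_compose_mult_distrib[OF f0] fps_compose_add_distrib
          flip: fps_compose_power[OF f0])
    have "(h oo f) ^ (p - 1) * (1 + of_nat (Suc i) * fps_X ^ (p - 1)) =
        (h oo f) ^ (p - 1) * (1 + fps_X ^ (p - 1) + of_nat i * (f ^ (p - 1) * (1 + fps_X ^ (p - 1))))"
      unfolding fp by (simp add: algebra_simps)
    also have "\<dots> = ((h oo f) ^ (p - 1) * (1 + of_nat i * f ^ (p - 1))) * (1 + fps_X ^ (p - 1))"
      by (simp add: algebra_simps)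
    also have "\<dots> = fps_X ^ (p - 1)" unfolding * by (rule fp)
    finally show ?case unfolding hf .
  qed
  from this[of p] have "(f [^]\<^bsub>Nott\<^esub> p) ^ (p - 1) = fps_X ^ (p - 1)"
    using of_nat_eq_0_iff_char_dvd[of p, where 'a = "'a fps"] by (simp add: CHAR_eq_p)
  then show ?thesis using Nott_eq_X_if_power_eq[of "f [^]\<^bsub>Nott\<^esub> p"] f by (simp add: f_def)
qed

end

section \<open>Normal subgroups of open subgroups\<close>

locale normal_in_open = prime_order_field p F for p and F :: "'a::field itself" +
  fixes U N :: "'a fps set"
  assumes U_subgroup_S: "subgroup U (Nott\<lparr>carrier := S_set p\<rparr>)"
    and U_open: "nott_open (S_set p) U"
    and N_normal: "N \<lhd> (Nott\<lparr>carrier := U\<rparr>)"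
begin

lemma U_subgroup: "subgroup U Nott"
  by (rule group.incl_subgroup[OF group_Nott S_subgroup U_subgroup_S])

lemma U_subset_S: "U \<subseteq> S_set p"
  using subgroup.subset[OF U_subgroup_S] by simp

lemma N_subset_U: "N \<subseteq> U"
  using subgroup.subset[OF normal_imp_subgroup[OF N_normal]] by simp

lemma N_subgroup: "subgroup N Nott"
  by (rule group.incl_subgroup[OF group_Nott U_subgroup normal_imp_subgroup[OF N_normal]])

lemma N_compose: "f \<in> N \<Longrightarrow> g \<in> N \<Longrightarrow> f oo g \<in> N"
  using subgroup.m_closed[OF N_subgroup] by (simp add: Nott_mult)

lemma N_in_Nott: "f \<in> N \<Longrightarrow> f \<in> carrier Nott"
  using subgroup.subset[OF N_subgroup] by blast

lemma X_in_N: "fps_X \<in> N"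
  using subgroup.one_closed[OF N_subgroup] by (simp add: Nott_one)

lemma U_level: "\<exists>n. \<forall>g\<in>S_set p. fps_X ^ n dvd g - fps_X \<longrightarrow> g \<in> U"
proof -
  have "fps_X \<in> U" using X_in_N N_subset_U by blast
  then show ?thesis using U_open by (simp add: nott_open_def agree_mod_iff_dvd)
qed

section \<open>Commutators in affine coordinates\<close>

lemma commutator_in_N:
  assumes "f \<in> N" "g \<in> U"
  obtains n where "n \<in> N" "n oo (g oo f) = f oo g"
proof -
  interpret group "Nott :: 'a fps monoid" by (rule group_Nott)
  have car: "f \<in> carrier Nott" "g \<in> carrier Nott"
    using assms N_in_Nott subgroup.subset[OF U_subgroup] by auto
  \<comment> \<open>The element taken is f g f^-1 g^-1. The product form of the conclusion allows
    coordinates to be compared without computing those of inverses.\<close>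
  have "inv\<^bsub>Nott\<^esub> f \<in> N" using assms(1) by (rule subgroup.m_inv_closed[OF N_subgroup])
  then have "g \<otimes>\<^bsub>Nott\<^esub> inv\<^bsub>Nott\<^esub> f \<otimes>\<^bsub>Nott\<^esub> inv\<^bsub>Nott\<^esub> g \<in> N"
    using normal.inv_op_closed2[OF N_normal, of g "inv\<^bsub>Nott\<^esub> f"] assms(2)
      m_inv_consistent[OF U_subgroup assms(2)] by simp
  then have "f \<otimes>\<^bsub>Nott\<^esub> (g \<otimes>\<^bsub>Nott\<^esub> inv\<^bsub>Nott\<^esub> f \<otimes>\<^bsub>Nott\<^esub> inv\<^bsub>Nott\<^esub> g) \<in> N"
    using subgroup.m_closed[OF N_subgroup assms(1)] by simp
  moreover have "f \<otimes>\<^bsub>Nott\<^esub> (g \<otimes>\<^bsub>Nott\<^esub> inv\<^bsub>Nott\<^esub> f \<otimes>\<^bsub>Nott\<^esub> inv\<^bsub>Nott\<^esub> g)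
      \<otimes>\<^bsub>Nott\<^esub> (g \<otimes>\<^bsub>Nott\<^esub> f) = f \<otimes>\<^bsub>Nott\<^esub> g"
    using car by (simp add: m_assoc inv_solve_left')
  ultimately show thesis using that by (simp add: Nott_mult)
qed

text \<open>With \<open>f = aff C D\<close> and \<open>g = aff A B\<close>, the series
  \<open>E\<close> and \<open>G\<close> are the differences of the linear and translation
  coordinates of \<open>f oo g\<close> and \<open>g oo f\<close>. They give the commutator up to one
  further order, since substituting a member of the Nottingham group and multiplying by a series
  with constant term \<open>1\<close> preserve leading terms. The bound \<open>l \<le> M\<close>
  keeps the mixed term \<open>w * F0\<close> negligible.\<close>

lemma commutator_coordinates:
  assumes f: "aff C D \<in> N" "fps_nth C 0 = 1" "fps_nth D 0 = 0"
    and g: "aff A B \<in> U" "fps_nth A 0 = 1" "fps_nth B 0 = 0"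
    and E: "E = (C oo aff A B) * A - (A oo aff C D) * C"
    and G: "G = (C oo aff A B) * B + (D oo aff A B) - (A oo aff C D) * D - (B oo aff C D)"
    and M: "fps_X ^ M dvd E" and l: "fps_X ^ l dvd G" "l \<le> M"
  obtains P Q where "aff P Q \<in> N" "fps_nth P 0 = 1" "fps_nth Q 0 = 0"
    "fps_X ^ Suc M dvd P - 1 - E" "fps_X ^ Suc l dvd Q - G"
proof -
  define E0 where "E0 = (A oo aff C D) * C"
  define F0 where "F0 = (A oo aff C D) * D + (B oo aff C D)"
  define q where "q = aff E0 F0"
  have f0: "fps_nth (aff C D) 0 = 0" and g0: "fps_nth (aff A B) 0 = 0"
    using aff_in_Nott f g by (simp_all add: Nott_carrier_iff)
  have E0: "fps_nth E0 0 = 1" and F0: "fps_nth F0 0 = 0"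
    using f g by (simp_all add: E0_def F0_def)
  then have q: "q \<in> carrier Nott" unfolding q_def by (rule aff_in_Nott)
  have q0: "fps_nth (aff E0 F0) 0 = 0" using q by (simp add: Nott_carrier_iff q_def)
  obtain n where n: "n \<in> N" "n oo (aff A B oo aff C D) = aff C D oo aff A B"
    using commutator_in_N[OF f(1) g(1)] .
  obtain P Q where PQ: "n = aff P Q" "fps_nth P 0 = 1" "fps_nth Q 0 = 0"
    using S_affE n(1) N_subset_U U_subset_S by blast
  have "aff A B oo aff C D = q"
    unfolding q_def E0_def F0_def by (rule aff_compose[OF f0])
  then have "aff ((P oo q) * E0) ((P oo q) * F0 + (Q oo q)) =
      aff ((C oo aff A B) * A) ((C oo aff A B) * B + (D oo aff A B))"
    using n(2) aff_compose[OF q0, of P Q] aff_compose[OF g0, of C D] by (simp add: PQ q_def)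
  note coords = aff_inject[OF this]
  define w where "w = ((P - 1) oo q)"
  have w: "w = (P oo q) - 1" by (simp add: w_def fps_compose_sub_distrib)
  have wE: "w * E0 = E"
    using coords(1) by (simp add: w E E0_def algebra_simps)
  have Qq: "(Q oo q) = G - w * F0"
    using coords(2) by (simp add: w G F0_def algebra_simps)
  have "fps_X ^ M dvd w * E0" using M wE by simp
  then have wM: "fps_X ^ M dvd w"
    by (rule fps_X_power_dvd_unit_cancel) (simp add: E0)
  have "fps_X ^ Suc M dvd w * (1 - E0)"
    by (rule fps_X_power_dvd_mult[OF wM, of 1]) (simp_all add: E0 fps_X_dvd_iff)
  moreover have "fps_X ^ Suc M dvd w - (P - 1)"
    unfolding w_def using wM unfolding w_def fps_X_power_dvd_compose_iff[OF q]
    by (rule fps_X_power_dvd_compose_Nott_diff[OF q])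
  moreover have "P - 1 - E = w * (1 - E0) - (w - (P - 1))"
    by (simp add: algebra_simps flip: wE)
  ultimately have 1: "fps_X ^ Suc M dvd P - 1 - E" by (metis dvd_diff)
  have "fps_X ^ Suc l dvd w * F0"
    by (rule fps_X_power_dvd_mult[OF wM, of 1]) (use l in \<open>simp_all add: F0 fps_X_dvd_iff\<close>)
  note wF = this
  have "fps_X ^ l dvd (Q oo q)"
    unfolding Qq by (rule dvd_diff[OF l(1) fps_X_power_dvd_weaken[OF wF]]) simp
  then have "fps_X ^ l dvd Q" by (simp add: fps_X_power_dvd_compose_iff[OF q])
  then have "fps_X ^ Suc l dvd (Q oo q) - Q"
    by (rule fps_X_power_dvd_compose_Nott_diff[OF q])
  moreover have "Q - G = - (w * F0) - ((Q oo q) - Q)" by (simp add: Qq)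
  ultimately have "fps_X ^ Suc l dvd Q - G" using wF by (metis dvd_diff dvd_minus_iff)
  with 1 n PQ that show thesis by blast
qed

text \<open>Take the commutator of \<open>aff C D\<close> with \<open>aff (1 + c X\<^sup>j) 0\<close> for a suitable scalar \<open>c\<close>.\<close>

lemma linear_commutator:
  assumes f: "aff C D \<in> N" "fps_nth C 0 = 1" "fps_nth D 0 = 0"
    and lead: "fps_X ^ (m + 2) dvd aff C D - fps_X - fps_const b * fps_X ^ Suc m" "b \<noteq> 0" "m \<ge> 1"
  shows "\<exists>j0. \<forall>j\<ge>j0. \<not> p dvd j \<longrightarrow> (\<forall>a. \<exists>P Q. aff P Q \<in> N \<and> fps_nth P 0 = 1 \<and> fps_nth Q 0 = 0 \<and>
    fps_X ^ Suc (j + m) dvd P - 1 - fps_const a * fps_X ^ (j + m) \<and> fps_X ^ j dvd Q)"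
proof -
  obtain u where u: "\<And>g. g \<in> S_set p \<Longrightarrow> fps_X ^ u dvd g - fps_X \<Longrightarrow> g \<in> U"
    using U_level by blast
  have "\<exists>P Q. aff P Q \<in> N \<and> fps_nth P 0 = 1 \<and> fps_nth Q 0 = 0 \<and>
    fps_X ^ Suc (j + m) dvd P - 1 - fps_const a * fps_X ^ (j + m) \<and> fps_X ^ j dvd Q"
    if j: "j \<ge> Suc (u + m)" "\<not> p dvd j" for j a
  proof -
    \<comment> \<open>The leading coefficient of \<open>E\<close> is \<open>- c * j * b\<close>,
      which this choice makes equal to \<open>a\<close>; \<open>p\<close> does not divide
      \<open>j\<close>, so the denominator is non-zero.\<close>
    define c where "c = - a / (of_nat j * b)"
    have c: "c * (of_nat j * b) = - a"
      using j(2) lead(2) by (simp add: c_def of_nat_eq_0_iff_p_dvd)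
    define A where "A = 1 + fps_const c * fps_X ^ j"
    have A0: "fps_nth A 0 = 1" using j by (simp add: A_def)
    have pj: "j + j \<le> p * j" by (rule double_le)
    have gX: "fps_X ^ Suc (p * j) dvd aff A 0 - fps_X"
      unfolding aff_minus_X using X_power_dvd_infl_minus_1_mult_X[of j A "Suc (p * j)"]
      by (simp add: A_def)
    have g: "aff A 0 \<in> U"
    proof (rule u)
      show "aff A 0 \<in> S_set p" by (rule aff_in_S) (simp_all add: A0)
      show "fps_X ^ u dvd aff A 0 - fps_X"
        by (rule fps_X_power_dvd_weaken[OF gX]) (use j pj in simp)
    qed
    have fN: "aff C D \<in> carrier Nott" using f(1) by (rule N_in_Nott)
    then have f0: "fps_nth (aff C D) 0 = 0" by (simp add: Nott_carrier_iff)
    have Af: "(A oo aff C D) = 1 + fps_const c * aff C D ^ j"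
      by (simp add: A_def fps_compose_add_distrib fps_compose_mult_distrib[OF f0] f0
          flip: fps_compose_power)
    define E where "E = (C oo aff A 0) * A - (A oo aff C D) * C"
    define G where "G = (C oo aff A 0) * 0 + (D oo aff A 0) - (A oo aff C D) * D - (0 oo aff C D)"
    have "fps_X ^ Suc (j + m) dvd E - fps_const a * fps_X ^ (j + m)"
    proof -
      define R where "R = aff C D ^ j - fps_X ^ j - fps_const (of_nat j * b) * fps_X ^ (m + j)"
      have R: "fps_X ^ Suc (j + m) dvd R"
        using fps_power_diff_leading[OF lead(1,3), of j] by (simp add: R_def add.commute)
      have "fps_const (- c) * (aff C D ^ j - fps_X ^ j) =
          fps_const (- c) * R + fps_const (- (c * (of_nat j * b))) * fps_X ^ (j + m)"
        by (simp add: R_def algebra_simps flip: fps_const_neg fps_const_mult)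
      then have d: "A - (A oo aff C D) = fps_const (- c) * R + fps_const a * fps_X ^ (j + m)"
        unfolding Af c by (simp add: A_def algebra_simps flip: fps_const_neg)
      have e: "E - fps_const a * fps_X ^ (j + m) = ((C oo aff A 0) - C) * A
          + fps_const (- c) * R * C + fps_const a * fps_X ^ (j + m) * (C - 1)"
      proof -
        have "E = ((C oo aff A 0) - C) * A + (A - (A oo aff C D)) * C"
          by (simp add: E_def algebra_simps)
        then show ?thesis unfolding d by (simp add: algebra_simps)
      qed
      \<comment> \<open>Substituting \<open>aff A 0\<close> changes \<open>C\<close> only from order
        \<open>p * j \<ge> j + j > j + m\<close> on.\<close>
      have "fps_X ^ Suc (j + m) dvd (C oo aff A 0) - C"
        by (rule fps_X_power_dvd_compose_diff[OF _ gX, of 0]) (use j pj in simp_all)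
      moreover have "fps_X ^ Suc (j + m) dvd fps_const a * fps_X ^ (j + m) * (C - 1)"
        by (rule fps_X_power_dvd_mult[of "j + m" _ 1]) (simp_all add: f fps_X_dvd_iff)
      ultimately show ?thesis unfolding e using R by (intro dvd_add) (auto intro: dvd_mult2 dvd_mult)
    qed
    note E = this
    then have EM: "fps_X ^ (j + m) dvd E" by (rule fps_X_power_dvd_of_dvd_diff) simp
    have GG: "G = ((D oo aff A 0) - D) - fps_const c * aff C D ^ j * D"
      by (simp add: G_def Af algebra_simps)
    have "fps_X ^ j dvd (D oo aff A 0) - D"
      by (rule fps_X_power_dvd_compose_diff[OF _ gX, of 0]) (simp_all add: le_p_mult del: mult_le_cancel2)
    moreover have "fps_X ^ j dvd fps_const c * aff C D ^ j * D"
      by (rule dvd_mult2[OF dvd_mult[OF dvd_power_same]]) (simp add: fps_X_dvd_iff f0)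
    ultimately have Gj: "fps_X ^ j dvd G" unfolding GG by (rule dvd_diff)
    obtain P Q where PQ: "aff P Q \<in> N" "fps_nth P 0 = 1" "fps_nth Q 0 = 0"
        "fps_X ^ Suc (j + m) dvd P - 1 - E" "fps_X ^ Suc j dvd Q - G"
      by (rule commutator_coordinates[OF f g A0 _ E_def G_def EM Gj]) auto
    have "fps_X ^ Suc (j + m) dvd P - 1 - fps_const a * fps_X ^ (j + m)"
      using PQ(4) E by (rule dvd_diff_trans)
    moreover have "fps_X ^ j dvd Q" using PQ(5) Gj by (rule fps_X_power_dvd_of_dvd_diff)
    ultimately show ?thesis using PQ by blast
  qed
  then show ?thesis by blast
qed

text \<open>Take the commutator of \<open>aff C D\<close> with the translation \<open>aff 1 ((b/c) X\<^sup>k)\<close>, where \<open>l = e + k\<close>. The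
  linear part of the result is trivial to an order growing \<open>p\<close> times as fast as \<open>l\<close>.\<close>

lemma translation_commutator:
  assumes f: "aff C D \<in> N" "fps_nth C 0 = 1" "fps_nth D 0 = 0"
    and lead: "fps_X ^ Suc e dvd C - 1 - fps_const c * fps_X ^ e" "c \<noteq> 0" "e \<ge> 1"
    and fX: "fps_X ^ (e + 2) dvd aff C D - fps_X"
  shows "\<exists>l0. \<forall>l\<ge>l0. \<forall>b. \<exists>P Q. aff P Q \<in> N \<and> fps_nth P 0 = 1 \<and> fps_nth Q 0 = 0 \<and>
    fps_X ^ (p * l - p * e) dvd P - 1 \<and> fps_X ^ Suc l dvd Q - fps_const b * fps_X ^ l"
proof -
  obtain u where u: "\<And>g. g \<in> S_set p \<Longrightarrow> fps_X ^ u dvd g - fps_X \<Longrightarrow> g \<in> U"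
    using U_level by blast
  have "\<exists>P Q. aff P Q \<in> N \<and> fps_nth P 0 = 1 \<and> fps_nth Q 0 = 0 \<and>
    fps_X ^ (p * l - p * e) dvd P - 1 \<and> fps_X ^ Suc l dvd Q - fps_const b * fps_X ^ l"
    if l: "l \<ge> Suc (u + e + e)" for l b
  proof -
    define k where "k = l - e"
    have k: "l = e + k" "k \<ge> Suc (u + e)" using l by (simp_all add: k_def)
    have pk: "k + k \<le> p * k" by (rule double_le)
    \<comment> \<open>The product of \<open>B\<close> with the leading term of \<open>C - 1\<close>
      dominates \<open>G\<close>; dividing by \<open>c\<close> normalises its coefficient to
      \<open>b\<close>.\<close>
    define B where "B = fps_const (b / c) * fps_X ^ k"
    have B0: "fps_nth B 0 = 0" using k by (simp add: B_def)
    have gX: "fps_X ^ (p * k) dvd aff 1 B - fps_X"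
      unfolding aff_minus_X using X_power_dvd_infl[of k B "p * k"] by (simp add: B_def)
    moreover have "Suc (p * k - 1) = p * k" using k(2) pk by linarith
    ultimately have gX': "fps_X ^ Suc (p * k - 1) dvd aff 1 B - fps_X" by presburger
    have g: "aff 1 B \<in> U"
    proof (rule u)
      show "aff 1 B \<in> S_set p" by (rule aff_in_S) (simp_all add: B0)
      show "fps_X ^ u dvd aff 1 B - fps_X"
        by (rule fps_X_power_dvd_weaken[OF gX]) (use k pk in simp)
    qed
    define E where "E = (C oo aff 1 B) * 1 - (1 oo aff C D) * C"
    define G where "G = (C oo aff 1 B) * B + (D oo aff 1 B) - (1 oo aff C D) * D - (B oo aff C D)"
    have "E = ((C - 1) oo aff 1 B) - (C - 1)"
      by (simp add: E_def fps_compose_sub_distrib)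
    moreover have "fps_X ^ (p * k) dvd ((C - 1) oo aff 1 B) - (C - 1)"
      by (rule fps_X_power_dvd_compose_diff[OF _ gX', of 1]) (simp_all add: f fps_X_dvd_iff)
    ultimately have E: "fps_X ^ (p * k) dvd E" by simp
    have "fps_X ^ Suc l dvd G - fps_const b * fps_X ^ l"
    proof -
      have "fps_const b * fps_X ^ l = fps_const c * fps_X ^ e * B"
        using lead(2) by (simp add: B_def k(1) power_add)
      then have "G - fps_const b * fps_X ^ l = E * B + (C - 1 - fps_const c * fps_X ^ e) * B
          + ((D oo aff 1 B) - D) - ((B oo aff C D) - B)"
        by (simp add: G_def E_def algebra_simps)
      moreover have "fps_X ^ Suc l dvd E * B"
        by (rule dvd_mult2, rule fps_X_power_dvd_weaken[OF E]) (use k pk in simp)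
      moreover have "fps_X ^ Suc l dvd (C - 1 - fps_const c * fps_X ^ e) * B"
        by (rule fps_X_power_dvd_mult[OF lead(1), of k]) (simp_all add: B_def k)
      moreover have "fps_X ^ Suc l dvd (D oo aff 1 B) - D"
        by (rule fps_X_power_dvd_compose_diff[OF _ gX', of 1])
           (use k pk in \<open>simp_all add: f fps_X_dvd_iff\<close>)
      \<comment> \<open>This competing term is pushed past \<open>l = e + k\<close> by the depth at
        least \<open>e + 1\<close> of \<open>aff C D\<close>, supplied by \<open>fX\<close>.\<close>
      moreover have "fps_X ^ Suc l dvd (B oo aff C D) - B"
        by (rule fps_X_power_dvd_compose_diff[of k _ "Suc e"])
           (use fX k in \<open>simp_all add: B_def\<close>)
      ultimately show ?thesis by (metis dvd_add dvd_diff)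
    qed
    note G = this
    then have Gl: "fps_X ^ l dvd G" by (rule fps_X_power_dvd_of_dvd_diff) simp
    have "l \<le> p * k" using k pk by simp
    then obtain P Q where PQ: "aff P Q \<in> N" "fps_nth P 0 = 1" "fps_nth Q 0 = 0"
        "fps_X ^ Suc (p * k) dvd P - 1 - E" "fps_X ^ Suc l dvd Q - G"
      by (rule commutator_coordinates[OF f g _ B0 E_def G_def E Gl, rotated]) auto
    have "fps_X ^ (p * k) dvd P - 1" using PQ(4) E by (rule fps_X_power_dvd_of_dvd_diff)
    moreover have "p * l - p * e = p * k" by (simp add: k_def diff_mult_distrib2)
    moreover have "fps_X ^ Suc l dvd Q - fps_const b * fps_X ^ l"
      using PQ(5) G by (rule dvd_diff_trans)
    ultimately show ?thesis using PQ by metis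
  qed
  then show ?thesis by blast
qed

text \<open>The loss \<open>K\<close> does not depend on \<open>l\<close>: as
  \<open>p \<ge> 2\<close>, the order \<open>p * l - K\<close> eventually exceeds \<open>l\<close>
  plus any constant.\<close>

definition near_translations :: "nat \<Rightarrow> nat \<Rightarrow> bool" where
  "near_translations l0 K \<longleftrightarrow> (\<forall>l\<ge>l0. \<forall>b. \<exists>P Q. aff P Q \<in> N \<and> fps_nth P 0 = 1 \<and> fps_nth Q 0 = 0 \<and>
    fps_X ^ (p * l - K) dvd P - 1 \<and> fps_X ^ Suc l dvd Q - fps_const b * fps_X ^ l)"

text \<open>Left composition with a near translation cancels the lowest remaining coefficient of
  \<open>Q\<close>. Its linear coordinate is \<open>1\<close> modulo \<open>fps_X ^ Suc M\<close>
  because \<open>p * l \<ge> K + M + 1\<close>, so the leading term of the linear part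
  survives.\<close>

lemma clear_translation_part:
  assumes near: "near_translations l0 K"
    and f: "aff P Q \<in> N" "fps_nth P 0 = 1" "fps_nth Q 0 = 0"
    and lead: "fps_X ^ Suc M dvd P - 1 - fps_const a * fps_X ^ M"
    and l: "fps_X ^ l dvd Q" "l \<ge> l0" "p * l \<ge> K + M + 1"
  shows "\<exists>P Q. aff P Q \<in> N \<and> fps_nth P 0 = 1 \<and> fps_nth Q 0 = 0 \<and>
    fps_X ^ Suc M dvd P - 1 - fps_const a * fps_X ^ M \<and> fps_X ^ (l + r) dvd Q"
proof (induction r)
  case 0
  then show ?case using f lead l(1) by auto
next
  case (Suc r)
  then obtain P Q where PQ: "aff P Q \<in> N" "fps_nth P 0 = 1" "fps_nth Q 0 = 0"
    "fps_X ^ Suc M dvd P - 1 - fps_const a * fps_X ^ M" "fps_X ^ (l + r) dvd Q" by blast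
  define b where "b = - fps_nth Q (l + r)"
  have "l + r \<ge> l0" using l(2) by simp
  then obtain R T where RT: "aff R T \<in> N" "fps_nth R 0 = 1" "fps_nth T 0 = 0"
    "fps_X ^ (p * (l + r) - K) dvd R - 1" "fps_X ^ Suc (l + r) dvd T - fps_const b * fps_X ^ (l + r)"
    using near unfolding near_translations_def by blast
  define n where "n = aff P Q"
  have nN: "n \<in> carrier Nott" unfolding n_def using PQ(1) by (rule N_in_Nott)
  then have n0: "fps_nth (aff P Q) 0 = 0" by (simp add: Nott_carrier_iff n_def)
  have comp: "aff R T oo n = aff ((R oo n) * P) ((R oo n) * Q + (T oo n))"
    unfolding n_def by (rule aff_compose[OF n0])
  have "p * l \<le> p * (l + r)" by simp
  then have le: "Suc M \<le> p * (l + r) - K" using l(3) by linarith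
  have "fps_X ^ Suc M dvd R - 1" by (rule fps_X_power_dvd_weaken[OF RT(4) le])
  then have "fps_X ^ Suc M dvd ((R - 1) oo n)" by (simp only: fps_X_power_dvd_compose_iff[OF nN])
  then have Rn: "fps_X ^ Suc M dvd (R oo n) - 1" by (simp add: fps_compose_sub_distrib)
  have "fps_X ^ Suc M dvd (R oo n) * P - 1 - fps_const a * fps_X ^ M"
  proof -
    have "(R oo n) * P - 1 - fps_const a * fps_X ^ M
        = ((R oo n) - 1) * P + (P - 1 - fps_const a * fps_X ^ M)" by (simp add: algebra_simps)
    then show ?thesis using dvd_add[OF dvd_mult2[OF Rn] PQ(4)] by presburger
  qed
  moreover have "fps_X ^ (l + Suc r) dvd (R oo n) * Q + (T oo n)"
  proof -
    have "(R oo n) * Q + (T oo n) = ((R oo n) - 1) * Q + (Q + fps_const b * fps_X ^ (l + r))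
        + ((T oo n) - T) + (T - fps_const b * fps_X ^ (l + r))" by (simp add: algebra_simps)
    moreover have "fps_X ^ Suc (l + r) dvd ((R oo n) - 1) * Q"
      by (rule fps_X_power_dvd_mult[OF Rn PQ(5)]) simp
    moreover have "fps_X ^ Suc (l + r) dvd Q + fps_const b * fps_X ^ (l + r)"
      using PQ(5) unfolding fps_X_power_dvd_iff by (auto simp: b_def less_Suc_eq)
    moreover have "fps_X ^ (l + r) dvd T" using RT(5) by (rule fps_X_power_dvd_of_dvd_diff) simp
    then have "fps_X ^ Suc (l + r) dvd (T oo n) - T"
      by (rule fps_X_power_dvd_compose_Nott_diff[OF nN])
    ultimately show ?thesis using RT(5) by (metis dvd_add add_Suc_right)
  qed
  moreover have "aff ((R oo n) * P) ((R oo n) * Q + (T oo n)) \<in> N"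
    using N_compose[OF RT(1) PQ(1)] comp by (simp add: n_def)
  moreover have "fps_nth ((R oo n) * P) 0 = 1" "fps_nth ((R oo n) * Q + (T oo n)) 0 = 0"
    using PQ RT by simp_all
  ultimately show ?case by blast
qed

text \<open>The commutator with exponent \<open>j = M - m\<close> prime to \<open>p\<close> has the
  right linear part but a translation part known only to order \<open>j\<close>; the missing
  \<open>Suc m\<close> orders are cleared, which \<open>p * j \<ge> j + j\<close> permits for large
  \<open>j\<close>.\<close>

lemma linear_elements:
  assumes near: "near_translations l0 K"
    and f: "f \<in> N" "fps_X ^ (m + 2) dvd f - fps_X - fps_const b * fps_X ^ Suc m" "b \<noteq> 0" "m \<ge> 1"
  shows "\<exists>M0. \<forall>M\<ge>M0. \<not> p dvd M - m \<longrightarrow> (\<forall>a. \<exists>P Q. aff P Q \<in> N \<and> fps_nth P 0 = 1 \<and> fps_nth Q 0 = 0 \<and>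
    fps_X ^ Suc M dvd P - 1 - fps_const a * fps_X ^ M \<and> fps_X ^ Suc M dvd Q)"
proof -
  obtain C D where CD: "f = aff C D" "fps_nth C 0 = 1" "fps_nth D 0 = 0"
    using S_affE f(1) N_subset_U U_subset_S by blast
  obtain j0 where j0: "\<And>j a. j \<ge> j0 \<Longrightarrow> \<not> p dvd j \<Longrightarrow> \<exists>P Q. aff P Q \<in> N \<and> fps_nth P 0 = 1 \<and>
      fps_nth Q 0 = 0 \<and> fps_X ^ Suc (j + m) dvd P - 1 - fps_const a * fps_X ^ (j + m) \<and> fps_X ^ j dvd Q"
    using linear_commutator[of C D m b] f CD by blast
  have "\<exists>P Q. aff P Q \<in> N \<and> fps_nth P 0 = 1 \<and> fps_nth Q 0 = 0 \<and>
    fps_X ^ Suc M dvd P - 1 - fps_const a * fps_X ^ M \<and> fps_X ^ Suc M dvd Q"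
    if M: "M \<ge> j0 + l0 + K + m + m + 1" "\<not> p dvd M - m" for M a
  proof -
    define j where "j = M - m"
    have j: "M = j + m" "j \<ge> j0" "j \<ge> l0" "j \<ge> K + m + 1" using M(1) by (simp_all add: j_def)
    obtain P Q where PQ: "aff P Q \<in> N" "fps_nth P 0 = 1" "fps_nth Q 0 = 0"
      "fps_X ^ Suc M dvd P - 1 - fps_const a * fps_X ^ M" "fps_X ^ j dvd Q"
      using j0[OF j(2), of a] M(2) unfolding j(1) by auto
    have "p * j \<ge> K + M + 1" using double_le[of j] j by linarith
    then show ?thesis
      using clear_translation_part[OF near PQ j(3), of "Suc m"] by (simp add: j(1))
  qed
  then show ?thesis by blast
qed

text \<open>Two commutators in succession: the first creates a linear part with known leading term,
  the second, against translations, yields the family.\<close>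

lemma near_translations_exist:
  assumes "N \<noteq> {fps_X}"
  shows "\<exists>l0 K. near_translations l0 K"
proof -
  obtain f where f: "f \<in> N" "f \<noteq> fps_X" using assms X_in_N by blast
  obtain m b where mb: "fps_X ^ (m + 2) dvd f - fps_X - fps_const b * fps_X ^ Suc m" "b \<noteq> 0" "m \<ge> 1"
    using leading_term[OF N_in_Nott[OF f(1)] f(2)] .
  obtain C D where CD: "f = aff C D" "fps_nth C 0 = 1" "fps_nth D 0 = 0"
    using S_affE f(1) N_subset_U U_subset_S by blast
  obtain j0 where j0: "\<And>j a. j \<ge> j0 \<Longrightarrow> \<not> p dvd j \<Longrightarrow> \<exists>P Q. aff P Q \<in> N \<and> fps_nth P 0 = 1 \<and>
      fps_nth Q 0 = 0 \<and> fps_X ^ Suc (j + m) dvd P - 1 - fps_const a * fps_X ^ (j + m) \<and> fps_X ^ j dvd Q"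
    using linear_commutator[of C D m b] f(1) CD mb by blast
  \<comment> \<open>Congruent to \<open>1\<close> modulo \<open>p\<close>, hence prime to
    \<open>p\<close>, and large enough that \<open>p * j \<ge> e + 2\<close>, as \<open>fX\<close>
    requires.\<close>
  define j where "j = Suc (p * (j0 + m + 2))"
  define e where "e = j + m"
  have "j0 + m + 2 \<le> p * (j0 + m + 2)" by (rule le_p_mult)
  then have j: "j \<ge> j0" "j \<ge> m + 2" by (simp_all add: j_def)
  have "\<not> p dvd j"
    using p_ge_2 dvd_add_right_iff[of p "p * (j0 + m + 2)" 1] by (simp add: j_def)
  then obtain P Q where PQ: "aff P Q \<in> N" "fps_nth P 0 = 1" "fps_nth Q 0 = 0"
    "fps_X ^ Suc e dvd P - 1 - fps_const 1 * fps_X ^ e" "fps_X ^ j dvd Q"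
    using j0[OF j(1), of 1] unfolding e_def by blast
  have fX: "fps_X ^ (e + 2) dvd aff P Q - fps_X"
  proof (rule aff_minus_X_dvd)
    show "fps_X ^ e dvd P - 1" using PQ(4) by (rule fps_X_power_dvd_of_dvd_diff) simp
    show "fps_X ^ j dvd Q" by (rule PQ)
    show "e + 2 \<le> p * e + 1" "e + 2 \<le> p * j"
      using double_le[of e] double_le[of j] j
      unfolding e_def by linarith+
  qed
  have "e \<ge> 1" using j by (simp add: e_def)
  then show ?thesis
    using translation_commutator[OF PQ(1-4) one_neq_zero _ fX] unfolding near_translations_def by blast
qed

section \<open>Realising every admissible leading term of large order\<close>

lemma all_leading_terms:
  assumes "N \<noteq> {fps_X}"
  shows "\<exists>n0. \<forall>n\<ge>n0. (p dvd n \<or> p dvd n - 1) \<longrightarrow>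
    (\<forall>a. \<exists>s\<in>N. fps_X ^ Suc n dvd s - fps_X - fps_const a * fps_X ^ n)"
proof -
  obtain l0 K where near: "near_translations l0 K" using near_translations_exist[OF assms] by blast
  have T: "\<exists>s\<in>N. fps_X ^ Suc (p * l) dvd s - fps_X - fps_const b * fps_X ^ (p * l)"
    if l: "l \<ge> l0 + K" for l b
  proof -
    have "l \<ge> l0" using l by simp
    then obtain P Q where PQ: "aff P Q \<in> N" "fps_X ^ (p * l - K) dvd P - 1"
      "fps_X ^ Suc l dvd Q - fps_const b * fps_X ^ l"
      using near unfolding near_translations_def by blast
    have "l \<le> p * l - K" using double_le[of l] l by linarith
    then show ?thesis
      using translation_depth[OF fps_X_power_dvd_weaken[OF PQ(2)] PQ(3)] PQ(1) by blast
  qed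
  define lin where "lin M \<longleftrightarrow> (\<forall>a. \<exists>P Q. aff P Q \<in> N \<and> fps_nth P 0 = 1 \<and> fps_nth Q 0 = 0 \<and>
    fps_X ^ Suc M dvd P - 1 - fps_const a * fps_X ^ M \<and> fps_X ^ Suc M dvd Q)" for M
  have linD: "\<exists>s\<in>N. fps_X ^ (p * M + 2) dvd s - fps_X - fps_const a * fps_X ^ Suc (p * M)"
    if "lin M" for M a
    using that linear_depth unfolding lin_def by blast
  \<comment> \<open>A near translation with leading exponent \<open>p * L\<close> has depth
    \<open>p * L - 1\<close>, so it supplies all large \<open>M\<close> not congruent to
    \<open>-1\<close> modulo \<open>p\<close>.\<close>
  define L where "L = l0 + K + 1"
  obtain h where h: "h \<in> N" "fps_X ^ Suc (p * L) dvd h - fps_X - fps_const 1 * fps_X ^ (p * L)"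
    using T[of L 1] by (auto simp: L_def)
  have pL: "p * L \<ge> 2" using mult_le_mono[OF p_ge_2, of 1 L] by (simp add: L_def)
  define m where "m = p * L - 1"
  have m: "p * L = Suc m" "m \<ge> 1" using pL by (simp_all add: m_def)
  have "fps_X ^ (m + 2) dvd h - fps_X - fps_const 1 * fps_X ^ Suc m"
    using h(2) by (simp only: m(1) add_2_eq_Suc')
  then obtain M1 where M1: "\<And>M. M \<ge> M1 \<Longrightarrow> \<not> p dvd M - (p * L - 1) \<Longrightarrow> lin M"
    using linear_elements[OF near h(1), of m 1] m(2) one_neq_zero unfolding lin_def m_def by blast
  \<comment> \<open>A multiple of \<open>p\<close> is not congruent to \<open>-1\<close>, so
    \<open>I\<close> is already supplied; the resulting \<open>z\<close> has depth
    \<open>p * I\<close>, congruent to \<open>0\<close>.\<close>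
  define I where "I = p * (M1 + L)"
  have "lin I"
  proof (rule M1)
    have "M1 + L + (M1 + L) \<le> I" unfolding I_def by (rule double_le)
    then show "I \<ge> M1" by simp
    have "I - (p * L - 1) = Suc (p * M1)" using pL by (simp add: I_def algebra_simps)
    then show "\<not> p dvd I - (p * L - 1)"
      using p_ge_2 dvd_add_right_iff[of p "p * M1" 1] by simp
  qed
  then obtain z where z: "z \<in> N" "fps_X ^ (p * I + 2) dvd z - fps_X - fps_const 1 * fps_X ^ Suc (p * I)"
    using linD by blast
  have "I \<ge> 1" using p_ge_2 by (simp add: I_def L_def)
  then have "p * I \<ge> 1" using p_ge_2 by simp
  then obtain M2 where M2: "\<And>M. M \<ge> M2 \<Longrightarrow> \<not> p dvd M - p * I \<Longrightarrow> lin M"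
    using linear_elements[OF near z(1), of "p * I" 1] z(2) unfolding lin_def by auto
  \<comment> \<open>Only multiples of \<open>p\<close> escape \<open>z\<close>; for these
    \<open>M - (p * L - 1)\<close> is congruent to \<open>1\<close>, so \<open>h\<close> covers
    them.\<close>
  have lin: "lin M" if M: "M \<ge> M1 + M2 + p * I + p * L" for M
  proof (cases "p dvd M - p * I")
    case False
    then show ?thesis using M2[of M] M by simp
  next
    case True
    then have "p dvd M - p * I + p * I" by (intro dvd_add) simp_all
    then have pM: "p dvd M" using M by simp
    have "\<not> p dvd M - (p * L - 1)"
    proof
      assume "p dvd M - (p * L - 1)"
      moreover have "M - (p * L - 1) = (M - p * L) + 1" using M pL by simp
      moreover have "p dvd M - p * L" using pM by (rule dvd_diff_nat) simp
      ultimately have "p dvd 1" by (metis dvd_add_right_iff)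
      then show False using p_ge_2 by simp
    qed
    then show ?thesis using M1[of M] M by simp
  qed
  define n0 where "n0 = p * (l0 + K + (M1 + M2 + p * I + p * L)) + 2"
  have "\<exists>s\<in>N. fps_X ^ Suc n dvd s - fps_X - fps_const a * fps_X ^ n"
    if n: "n \<ge> n0" "p dvd n \<or> p dvd n - 1" for n a
    using n(2)
  proof
    assume "p dvd n"
    then obtain l where l: "n = p * l" by (rule dvdE)
    then have "p * (l0 + K) \<le> p * l" using n(1) by (simp add: n0_def algebra_simps)
    then have "l0 + K \<le> l" using p_ge_2 by simp
    then show ?thesis using T[of l a] by (simp only: l)
  next
    assume "p dvd n - 1"
    then obtain l where "n - 1 = p * l" by (rule dvdE)
    then have l: "n = Suc (p * l)" using n(1) by (simp add: n0_def)
    then have "p * (M1 + M2 + p * I + p * L) \<le> p * l" using n(1) by (simp add: n0_def algebra_simps)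
    then have "M1 + M2 + p * I + p * L \<le> l" using p_ge_2 by simp
    then show ?thesis using linD[OF lin, of l a] by (simp add: l)
  qed
  then show ?thesis by blast
qed

section \<open>Openness by successive approximation\<close>

lemma N_level:
  assumes closed: "nott_closed U N" and nontriv: "N \<noteq> {fps_X}"
  shows "\<exists>n. \<forall>f\<in>U. fps_X ^ n dvd f - fps_X \<longrightarrow> f \<in> N"
proof -
  obtain n0 where n0: "\<forall>n\<ge>n0. p dvd n \<or> p dvd n - 1 \<longrightarrow>
      (\<forall>a. \<exists>s\<in>N. fps_X ^ Suc n dvd s - fps_X - fps_const a * fps_X ^ n)"
    using all_leading_terms[OF nontriv] ..
  \<comment> \<open>The offset \<open>2\<close> ensures \<open>k \<ge> 2\<close> below, where the
    support condition of \<open>S_set\<close> applies.\<close>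
  have "f \<in> N" if f: "f \<in> U" "fps_X ^ (n0 + 2) dvd f - fps_X" for f
  proof (rule ccontr)
    assume "f \<notin> N"
    \<comment> \<open>Left composition with an element of prescribed leading term corrects the
      coefficient at \<open>k\<close>; at inadmissible \<open>k\<close> both series vanish.
      Closedness of \<open>N\<close> then contradicts the choice of \<open>f\<close>.\<close>
    have approx: "\<exists>g\<in>N. fps_X ^ (n0 + 2 + n) dvd g - f" for n
    proof (induction n)
      case 0
      have "fps_X ^ (n0 + 2 + 0) dvd fps_X - f" using f(2) by (subst dvd_diff_commute) simp
      then show ?case using X_in_N by blast
    next
      case (Suc n)
      define k where "k = n0 + 2 + n"
      obtain g where g: "g \<in> N" "fps_X ^ k dvd g - f" using Suc by (auto simp: k_def)
      define a where "a = fps_nth (f - g) k"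
      show ?case
      proof (cases "p dvd k \<or> p dvd k - 1")
        case True
        have "k \<ge> n0" by (simp add: k_def)
        then obtain s where s: "s \<in> N" "fps_X ^ Suc k dvd s - fps_X - fps_const a * fps_X ^ k"
          using n0 True by blast
        have gN: "g \<in> carrier Nott" using g(1) by (rule N_in_Nott)
        then have g0: "fps_nth g 0 = 0" by (simp add: Nott_carrier_iff)
        have "fps_X ^ k dvd s - fps_X" using s(2) by (rule fps_X_power_dvd_of_dvd_diff) simp
        then have "fps_X ^ Suc k dvd ((s - fps_X) oo g) - (s - fps_X)"
          by (rule fps_X_power_dvd_compose_Nott_diff[OF gN])
        moreover have "fps_X ^ Suc k dvd fps_const a * fps_X ^ k - (f - g)"
          using g(2) unfolding fps_X_power_dvd_iff by (auto simp: a_def less_Suc_eq)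
        moreover have "(s oo g) - f = (((s - fps_X) oo g) - (s - fps_X))
            + (s - fps_X - fps_const a * fps_X ^ k) + (fps_const a * fps_X ^ k - (f - g))"
          by (simp add: fps_compose_sub_distrib g0)
        ultimately have "fps_X ^ Suc k dvd (s oo g) - f" using s(2) by (metis dvd_add)
        then show ?thesis using N_compose[OF s(1) g(1)] by (auto simp: k_def)
      next
        case False
        have "f \<in> S_set p" "g \<in> S_set p" using f(1) g(1) N_subset_U U_subset_S by auto
        moreover have "k \<ge> 2" by (simp add: k_def)
        ultimately have "fps_nth f k = 0" "fps_nth g k = 0" using False by (auto simp: S_set_def)
        then have "fps_X ^ Suc k dvd g - f"
          using g(2) unfolding fps_X_power_dvd_iff by (auto simp: less_Suc_eq)
        then show ?thesis using g(1) by (auto simp: k_def)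
      qed
    qed
    have "f \<in> U - N" using f(1) \<open>f \<notin> N\<close> by simp
    then obtain n where n: "\<And>g. g \<in> U \<Longrightarrow> fps_X ^ n dvd g - f \<Longrightarrow> g \<in> U - N"
      using closed unfolding nott_closed_def nott_open_def agree_mod_iff_dvd by blast
    obtain g where "g \<in> N" "fps_X ^ (n0 + 2 + n) dvd g - f" using approx by blast
    moreover from this have "fps_X ^ n dvd g - f" using fps_X_power_dvd_weaken by (metis le_add2)
    ultimately show False using n N_subset_U by blast
  qed
  then show ?thesis by blast
qed

text \<open>Openness at the identity spreads to every \<open>f \<in> N\<close>, since
  \<open>g oo fps_inv f\<close> is as close to \<open>fps_X\<close> as \<open>g\<close> is to
  \<open>f\<close>.\<close>

lemma N_open:
  assumes "nott_closed U N" "N \<noteq> {fps_X}"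
  shows "nott_open U N"
proof -
  obtain n where n: "\<And>f. f \<in> U \<Longrightarrow> fps_X ^ n dvd f - fps_X \<Longrightarrow> f \<in> N"
    using N_level[OF assms] by blast
  have "g \<in> N" if f: "f \<in> N" and g: "g \<in> U" "fps_X ^ n dvd g - f" for f g
  proof -
    have fN: "f \<in> carrier Nott" using f by (rule N_in_Nott)
    have "f \<in> U" using f N_subset_U by blast
    then have "fps_inv f \<in> U"
      using subgroup.m_inv_closed[OF U_subgroup, of f] by (simp only: Nott_inv[OF fN])
    then have "g oo fps_inv f \<in> U"
      using subgroup.m_closed[OF U_subgroup g(1)] by (simp add: Nott_mult)
    moreover have "fps_X ^ n dvd (g - f) oo fps_inv f"
      using g(2) by (simp add: fps_X_power_dvd_compose_iff[OF fps_inv_in_Nott[OF fN]])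
    then have "fps_X ^ n dvd (g oo fps_inv f) - fps_X"
      by (simp add: fps_compose_sub_distrib compose_fps_inv[OF fN])
    ultimately have "g oo fps_inv f \<in> N" by (rule n)
    then have "(g oo fps_inv f) oo f \<in> N" using f by (rule N_compose)
    then show ?thesis by (simp add: compose_fps_inv_cancel[OF fN])
  qed
  then show ?thesis unfolding nott_open_def agree_mod_iff_dvd using N_subset_U by blast
qed

end

theorem theorem6p3:
  fixes p :: nat
  assumes "Factorial_Ring.prime p" and "card (UNIV :: 'a set) = p"
  shows "nott_pro_p p (S_set p :: 'a::field fps set) \<and> nott_hji (S_set p :: 'a fps set) \<and>
         (\<exists>f \<in> (S_set p :: 'a fps set). f \<noteq> fps_X \<and> (\<exists>n>0. f [^]\<^bsub>Nott\<^esub> (n::nat) = fps_X))"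
proof (intro conjI)
  interpret prime_order_field p "TYPE('a)" using assms by unfold_locales
  show "nott_pro_p p (S_set p :: 'a fps set)" by (rule S_pro_p)
  show "nott_hji (S_set p :: 'a fps set)"
    unfolding nott_hji_def
  proof (intro conjI allI impI, rule S_infinite, elim conjE)
    fix U N :: "'a fps set"
    assume "subgroup U (Nott\<lparr>carrier := S_set p\<rparr>)" "nott_open (S_set p) U"
      "N \<lhd> (Nott\<lparr>carrier := U\<rparr>)" and N: "nott_closed U N" "N \<noteq> {fps_X}"
    then interpret normal_in_open p "TYPE('a)" U N
      by (intro normal_in_open.intro normal_in_open_axioms.intro prime_order_field_axioms)
    show "nott_open U N" using N by (rule N_open)
  qed
  show "\<exists>f \<in> (S_set p :: 'a fps set). f \<noteq> fps_X \<and> (\<exists>n>0. f [^]\<^bsub>Nott\<^esub> (n::nat) = fps_X)"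
    using X_W_in_S X_W_neq_X X_W_finite_order p_ge_2
    by (intro bexI[of _ "fps_X * W"] conjI exI[of _ p]) auto
qed

end
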